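(* Let $k$ be a field of characteristic zero, let $R = k[x_1,x_2,x_3,x_4]$, let $2 \le a_1 \le a_2 \le a_3 \le a_4 \le a_5$ be integers, let $L \in R$ be a general linear form, and let $I = \langle x_1^{a_1}, x_2^{a_2}, x_3^{a_3}, x_4^{a_4}, L^{a_5} \rangle$. Assume that $a_1+a_2+a_3+a_4$ is even, and set $\lambda = \frac{a_1+a_2+a_3+a_4}{2} - 2$. Then: (i) If $a_5 \ge \lambda$, then $R/I$ has the WLP. (ii) If $a_5 < \lambda$ and $a_1 + a_4 \ge a_2 + a_3$, then $R/I$ fails the WLP from degree $\lambda - 1$ to degree $\lambda$. (iii) If $a_5 < \lambda$, $a_1 + a_4 < a_2 + a_3$ and $2a_5 + a_1 - a_2 - a_3 - a_4 \ge 0$, then $R/I$ fails the WLP from degree $\lambda - 1$ to degree $\lambda$. Moreover, the hypotheses of (ii) and the hypotheses of (iii) both force $a_1 \ge 3$.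
   Context: "General linear form" means that the assertion holds for all linear forms whose coefficient vector lies in some nonempty Zariski-open subset of the space of linear forms $[R]_1$. A standard graded artinian $k$-algebra $A = R/I$ has the Weak Lefschetz Property (WLP) if, for a general linear form $\ell \in R$, the multiplication map $\times \ell : [A]_{t} \to [A]_{t+1}$ has maximal rank (i.e. is injective or surjective) for every integer $t$. "$A$ fails the WLP from degree $m-1$ to degree $m$" means that for a general linear form $\ell$ the map $\times \ell : [A]_{m-1} \to [A]_m$ does not have maximal rank. *)

theory Defs
  imports
    "HOL-Library.Poly_Mapping"
    "HOL-Library.Numeral_Type"
    "HOL-Algebra.QuotRing"
    "HOL-Algebra.Algebraic_Closure_Type"
begin

text \<open>
  A polynomial maps exponent vectors to coefficients, with finite support;
  multiplication on this type is convolution, so \<open>(4, 'k) mpoly\<close> is the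
  polynomial ring over \<open>'k\<close> in four variables.
\<close>

type_synonym ('n, 'k) mpoly = "('n \<Rightarrow>\<^sub>0 nat) \<Rightarrow>\<^sub>0 'k"

definition var :: "'n \<Rightarrow> ('n, 'k::comm_ring_1) mpoly"
  where "var i = Poly_Mapping.single (Poly_Mapping.single i 1) 1"

definition eval_mpoly :: "('n::finite \<Rightarrow> 'k) \<Rightarrow> ('n, 'k::comm_ring_1) mpoly \<Rightarrow> 'k"
  where "eval_mpoly c p =
    (\<Sum>m\<in>Poly_Mapping.keys p.
       Poly_Mapping.lookup p m * (\<Prod>i\<in>UNIV. c i ^ Poly_Mapping.lookup m i))"

definition zariski_closed :: "('n::finite \<Rightarrow> 'k::field) set \<Rightarrow> bool"
  where "zariski_closed Z \<longleftrightarrow> (\<exists>P. Z = {c. \<forall>p\<in>P. eval_mpoly c p = 0})"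

definition zariski_open :: "('n::finite \<Rightarrow> 'k::field) set \<Rightarrow> bool"
  where "zariski_open U \<longleftrightarrow> zariski_closed (- U)"

definition linear_form :: "('n::finite \<Rightarrow> 'k) \<Rightarrow> ('n, 'k::comm_ring_1) mpoly"
  where "linear_form c = (\<Sum>i\<in>UNIV. Poly_Mapping.single (Poly_Mapping.single i 1) (c i))"

definition for_general_linear_form :: "(('n::finite, 'k::field) mpoly \<Rightarrow> bool) \<Rightarrow> bool"
  where "for_general_linear_form P \<longleftrightarrow>
    (\<exists>U. zariski_open U \<and> U \<noteq> {} \<and> (\<forall>c\<in>U. P (linear_form c)))"

text \<open>
  Degrees are integers, so \<open>homogeneous_part d\<close> is \<open>{0}\<close> for negative \<open>d\<close>.
\<close>

definition homogeneous_part :: "int \<Rightarrow> ('n::finite, 'k::comm_ring_1) mpoly set"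
  where "homogeneous_part d =
    {f. \<forall>m\<in>Poly_Mapping.keys f. int (\<Sum>i\<in>UNIV. Poly_Mapping.lookup m i) = d}"

abbreviation mpoly_ring :: "('n, 'k::comm_ring_1) mpoly ring"
  where "mpoly_ring \<equiv> ring_of_type_algebra"

text \<open>
  The degree \<open>d\<close> component of the quotient by a homogeneous ideal \<open>I\<close>, as a set of
  cosets in \<open>mpoly_ring Quot I\<close>.
\<close>

definition quot_part :: "('n::finite, 'k::comm_ring_1) mpoly set \<Rightarrow> int \<Rightarrow> ('n, 'k) mpoly set set"
  where "quot_part I d = (\<lambda>f. I +>\<^bsub>mpoly_ring\<^esub> f) ` homogeneous_part d"

definition quot_times ::
    "('n, 'k::comm_ring_1) mpoly set \<Rightarrow> ('n, 'k) mpoly \<Rightarrow> ('n, 'k) mpoly set \<Rightarrow> ('n, 'k) mpoly set"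
  where "quot_times I l x = (I +>\<^bsub>mpoly_ring\<^esub> l) \<otimes>\<^bsub>mpoly_ring Quot I\<^esub> x"

definition maximal_rank_at :: "('n::finite, 'k::comm_ring_1) mpoly set \<Rightarrow> ('n, 'k) mpoly \<Rightarrow> int \<Rightarrow> bool"
  where "maximal_rank_at I l t \<longleftrightarrow>
    inj_on (quot_times I l) (quot_part I t) \<or>
    quot_times I l ` quot_part I t = quot_part I (t + 1)"

definition weak_lefschetz :: "('n::finite, 'k::field) mpoly set \<Rightarrow> bool"
  where "weak_lefschetz I \<longleftrightarrow> for_general_linear_form (\<lambda>l. \<forall>t. maximal_rank_at I l t)"

text \<open>Failure from degree \<open>m - 1\<close> to degree \<open>m\<close>.\<close>

definition fails_weak_lefschetz_to :: "('n::finite, 'k::field) mpoly set \<Rightarrow> int \<Rightarrow> bool"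
  where "fails_weak_lefschetz_to I m \<longleftrightarrow>
    for_general_linear_form (\<lambda>l. \<not> maximal_rank_at I l (m - 1))"

text \<open>
  The variables are indexed by the elements 1, 2, 3, 4 of the four-element numeral
  type, where 4 coincides with 0; these indices are pairwise distinct.
\<close>

definition power_ideal ::
    "nat \<Rightarrow> nat \<Rightarrow> nat \<Rightarrow> nat \<Rightarrow> nat \<Rightarrow> (4, 'k::field) mpoly \<Rightarrow> (4, 'k) mpoly set"
  where "power_ideal a1 a2 a3 a4 a5 L =
    Idl\<^bsub>mpoly_ring\<^esub> {var 1 ^ a1, var 2 ^ a2, var 3 ^ a3, var 4 ^ a4, L ^ a5}"

end

theory Submission
  imports Defs
begin

text \<open>
  Write \<open>C = R/(x\<^sub>1^a\<^sub>1, \<dots>, x\<^sub>4^a\<^sub>4)\<close> and \<open>A = R/I = C/L^a\<^sub>5C\<close>. Since the \<open>a\<^sub>i\<close>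
  with \<open>i \<le> 4\<close> have even sum, the socle of \<open>C\<close> lies in the even degree \<open>2\<lambda>\<close>, and \<open>C\<close> has a
  single middle degree \<open>\<lambda>\<close>. Let \<open>L = \<Sum> c\<^sub>i x\<^sub>i\<close> and \<open>\<ell> = \<Sum> b\<^sub>i x\<^sub>i\<close>. The argument works as
  soon as all \<open>c\<^sub>i\<close> and \<open>b\<^sub>i\<close> are nonzero and the ratios \<open>t\<^sub>i = c\<^sub>i/b\<^sub>i\<close> are pairwise distinct, so
  generality enters only through these explicit open conditions.

  \<^emph>\<open>The action of sl2.\<close> There is an operator \<open>Y\<close> of degree \<open>-1\<close> on \<open>C\<close> (\<open>lower\<close>) such that
  \<open>Y\<ell> - \<ell>Y\<close> is multiplication by \<open>2\<lambda> - 2d\<close> in degree \<open>d\<close>. This relation shows that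
  \<open>\<ell>^k\<close> is injective on \<open>C\<^sub>d\<close> if \<open>2d + k \<le> 2\<lambda>\<close> and surjective onto \<open>C\<^sub>d\<close> if
  \<open>2d - k \<ge> 2\<lambda>\<close> (\<open>lefschetz_injective\<close>, \<open>lefschetz_surjective\<close>); the same holds for \<open>L\<close>.

  \<^emph>\<open>Large \<open>a\<^sub>5\<close>.\<close> If \<open>a\<^sub>5 \<ge> \<lambda>\<close>, then \<open>A\<close> and \<open>C\<close> agree below degree \<open>\<lambda>\<close>, and \<open>A\<close> inherits
  surjectivity from \<open>C\<close> beyond it. The only delicate map is the one into degree \<open>\<lambda> = a\<^sub>5\<close>, which
  is injective if \<open>L^\<lambda>\<close> is not in \<open>\<ell>C\<close>.

  \<^emph>\<open>Failure of injectivity for small \<open>a\<^sub>5\<close>.\<close> In the middle degree \<open>Y\<close> and \<open>\<ell>\<close> commute. As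
  \<open>L^(\<lambda>+1) = \<ell>v\<close> in \<open>C\<close> for some \<open>v\<close>, the element \<open>f = Yv\<close> of degree \<open>\<lambda> - 1\<close> satisfies
  \<open>\<ell>f = Y L^(\<lambda>+1)\<close>. Since \<open>Y\<close> is a differential operator of order two, the right-hand side is
  \<open>L^(\<lambda>-1) u\<close> for a linear form \<open>u\<close>, so it vanishes in \<open>A\<close> when \<open>a\<^sub>5 < \<lambda>\<close>. If \<open>f\<close> vanished in
  \<open>A\<close>, cancelling \<open>L^a\<^sub>5\<close> would make \<open>L^(\<lambda>-1-a\<^sub>5) u\<close> a multiple of \<open>\<ell>\<close> in the degree
  \<open>\<lambda> - a\<^sub>5\<close>. In (ii) and (iii) this degree is less than \<open>a\<^sub>1\<close>, where \<open>C\<close> is still the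
  polynomial ring, and three distinct \<open>t\<^sub>i\<close> exclude it (\<open>not_injective_if_small_power\<close>).

  \<^emph>\<open>Failure of surjectivity for small \<open>a\<^sub>5\<close>.\<close> Under the apolarity pairing, multiplication by
  a linear form is adjoint to a directional derivative. Hence a nonzero form \<open>F\<close> of degree \<open>\<lambda>\<close>
  is orthogonal to \<open>I\<close> and to the multiples of \<open>\<ell>\<close> if it is invariant under translation along \<open>b\<close>, has
  degree less than \<open>a\<^sub>i\<close> in each variable, and has degree less than \<open>a\<^sub>5\<close> along \<open>c\<close>. Such
  an \<open>F\<close> is a product of differences \<open>x\<^sub>i/b\<^sub>i - x\<^sub>j/b\<^sub>j\<close> and of conics from the pencil through the
  coordinate points; every factor that is the conic vanishing at \<open>c\<close> lowers the degree along
  \<open>c\<close> by one (\<open>exists_invariant_form\<close>). The same products, without conics through \<open>c\<close>,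
  separate \<open>L^\<lambda>\<close> from \<open>\<ell>C\<close> in the delicate case above.
\<close>

abbreviation "lookup \<equiv> Poly_Mapping.lookup"
abbreviation "keys \<equiv> Poly_Mapping.keys"
abbreviation "single \<equiv> Poly_Mapping.single"

section \<open>Polynomials, evaluation and derivatives\<close>

lemma mpoly_induct [case_names zero single add]:
  fixes p :: "'m \<Rightarrow>\<^sub>0 'k::comm_ring_1"
  assumes "P 0" and "\<And>m c. P (single m c)" and "\<And>p q. P p \<Longrightarrow> P q \<Longrightarrow> P (p + q)"
  shows "P p"
proof (induction p rule: Poly_Mapping.update_induct)
  case const
  show ?case by (rule assms(1))
next
  case (update p m c)
  have "Poly_Mapping.update m c p = p + single m c"
    using update(1) by (intro poly_mapping_eqI)
      (auto simp: lookup_update lookup_add lookup_single in_keys_iff when_def)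
  with update assms show ?case by auto
qed

definition Const :: "'k::comm_ring_1 \<Rightarrow> ('n, 'k) mpoly"
  where "Const c = single 0 c"

lemma Const_add: "Const (c + d) = Const c + Const d"
  and Const_diff: "Const (c - d) = Const c - Const d"
  and Const_mult: "Const (c * d) = Const c * Const d"
  and Const_0 [simp]: "Const 0 = 0" and Const_1 [simp]: "Const 1 = 1"
  and Const_of_nat: "Const (of_nat n) = of_nat n" and Const_of_int: "Const (of_int i) = of_int i"
  by (simp_all add: Const_def single_add single_diff mult_single)

lemma Const_sum: "Const (\<Sum>i\<in>A. f i) = (\<Sum>i\<in>A. Const (f i))"
  by (induction A rule: infinite_finite_induct) (simp_all add: Const_add)

lemma linear_form_alt: "linear_form c = (\<Sum>i\<in>UNIV. Const (c i) * var i)"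
  by (simp add: linear_form_def Const_def var_def mult_single)

abbreviation unit_exp :: "'n \<Rightarrow> 'n \<Rightarrow>\<^sub>0 nat"
  where "unit_exp i \<equiv> single i 1"

lemma lookup_Const_times: "lookup (Const c * p) m = c * lookup p m"
  by (induction p rule: mpoly_induct)
    (auto simp: Const_def mult_single lookup_single when_def lookup_add algebra_simps)

lemma eval_add [simp]: "eval_mpoly c (p + q) = eval_mpoly c p + eval_mpoly c q"
  unfolding eval_mpoly_def by (rule setsum_keys_plus_distrib) (simp_all add: algebra_simps)

lemma eval_0 [simp]: "eval_mpoly c 0 = 0"
  by (simp add: eval_mpoly_def)

lemma eval_single: "eval_mpoly c (single m x) = x * (\<Prod>i\<in>UNIV. c i ^ lookup m i)"
  by (cases "x = 0") (simp_all add: eval_mpoly_def)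

lemma eval_mult [simp]: "eval_mpoly c (p * q) = eval_mpoly c p * eval_mpoly c q"
proof (induction p rule: mpoly_induct)
  case (single m x)
  show ?case
    by (induction q rule: mpoly_induct)
      (auto simp: mult_single eval_single lookup_add power_add prod.distrib algebra_simps)
qed (simp_all add: algebra_simps)

lemma eval_Const [simp]: "eval_mpoly c (Const x) = x"
  by (simp add: Const_def eval_single)

lemma eval_1 [simp]: "eval_mpoly c 1 = 1"
  by (metis Const_1 eval_Const)

lemma eval_uminus [simp]: "eval_mpoly c (- p) = - eval_mpoly c p"
  by (metis add.right_inverse add_eq_0_iff eval_0 eval_add)

lemma eval_diff [simp]: "eval_mpoly c (p - q) = eval_mpoly c p - eval_mpoly c q"
  by (metis add_uminus_conv_diff eval_add eval_uminus)

lemma eval_of_nat [simp]: "eval_mpoly c (of_nat n) = of_nat n"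
  by (metis Const_of_nat eval_Const)

lemma eval_power [simp]: "eval_mpoly c (p ^ n) = eval_mpoly c p ^ n"
  by (induction n) simp_all

lemma eval_sum [simp]: "eval_mpoly c (\<Sum>i\<in>A. f i) = (\<Sum>i\<in>A. eval_mpoly c (f i))"
  by (induction A rule: infinite_finite_induct) simp_all

lemma eval_prod [simp]: "eval_mpoly c (\<Prod>i\<in>A. f i) = (\<Prod>i\<in>A. eval_mpoly c (f i))"
  by (induction A rule: infinite_finite_induct) simp_all

lemma prod_power_unit: "(\<Prod>j\<in>UNIV. (c::'n::finite \<Rightarrow> 'k::comm_ring_1) j ^ lookup (unit_exp i) j) = c i"
proof -
  have "(\<Prod>j\<in>UNIV. c j ^ lookup (unit_exp i) j) = (\<Prod>j\<in>UNIV. if j = i then c j else 1)"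
    by (intro prod.cong) (auto simp: lookup_single when_def)
  thus ?thesis by simp
qed

lemma eval_var [simp]: "eval_mpoly c (var i) = c i"
  unfolding var_def eval_single prod_power_unit by simp

lemma eval_linear_form [simp]: "eval_mpoly c (linear_form b) = (\<Sum>i\<in>UNIV. b i * c i)"
  by (simp add: linear_form_alt)

text \<open>The description by coefficients makes linearity and the effect on degrees immediate.\<close>

lift_definition partial :: "'n \<Rightarrow> ('n, 'k::comm_ring_1) mpoly \<Rightarrow> ('n, 'k) mpoly"
  is "\<lambda>i p m. of_nat (Suc (lookup m i)) * p (m + unit_exp i)"
proof -
  fix i :: 'n and p :: "('n \<Rightarrow>\<^sub>0 nat) \<Rightarrow> 'k"
  assume "finite {m. p m \<noteq> 0}"
  hence "finite ((\<lambda>m. m + unit_exp i) -` {m. p m \<noteq> 0})"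
    by (intro finite_vimageI) (auto simp: inj_def)
  thus "finite {m. of_nat (Suc (lookup m i)) * p (m + unit_exp i) \<noteq> 0}"
    by (rule rev_finite_subset) auto
qed

lemma lookup_partial:
  "lookup (partial i p) m = of_nat (Suc (lookup m i)) * lookup p (m + unit_exp i)"
  by transfer simp

lemma partial_add [simp]: "partial i (p + q) = partial i p + partial i q"
  and partial_0 [simp]: "partial i 0 = 0"
  and partial_diff [simp]: "partial i (p - q) = partial i p - partial i q"
  by (rule poly_mapping_eqI; simp add: lookup_partial lookup_add lookup_minus algebra_simps)+

lemma partial_Const_times [simp]: "partial i (Const c * p) = Const c * partial i p"
  by (rule poly_mapping_eqI) (simp add: lookup_partial lookup_Const_times mult.left_commute del: of_nat_Suc)

lemma partial_single_add_unit:
  "partial i (single (m + unit_exp i) c) = single m (of_nat (Suc (lookup m i)) * c)"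
  by (rule poly_mapping_eqI) (auto simp: lookup_partial lookup_single when_def)

lemma partial_single_absent:
  assumes "lookup m i = 0"
  shows "partial i (single m c) = 0"
proof (rule poly_mapping_eqI)
  fix n
  have "n + unit_exp i \<noteq> m"
    using assms by (auto simp: lookup_add)
  thus "lookup (partial i (single m c)) n = lookup 0 n"
    by (auto simp: lookup_partial lookup_single when_def)
qed

lemma exp_split_unit:
  assumes "lookup m i \<noteq> 0"
  shows "\<exists>n. m = n + unit_exp i"
  using assms by (intro exI[of _ "m - unit_exp i"] poly_mapping_eqI)
    (auto simp: lookup_add lookup_minus lookup_single when_def)

lemma var_times_single: "var i * single m c = single (m + unit_exp i) c"
  by (simp add: var_def mult_single add.commute)

lemma of_nat_times_single: "of_nat k * single m c = single m (of_nat k * c)"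
  by (induction k) (simp_all add: algebra_simps single_add)

lemma var_times_partial_single: "var i * partial i (single m c) = of_nat (lookup m i) * single m c"
proof (cases "lookup m i = 0")
  case True
  thus ?thesis by (simp add: partial_single_absent)
next
  case False
  from exp_split_unit[OF this] obtain n where n: "m = n + unit_exp i" ..
  show ?thesis
    unfolding n partial_single_add_unit var_times_single of_nat_times_single by (simp add: lookup_add)
qed

lemma partial_single:
  "partial i (single m c) = single (m - unit_exp i) (of_nat (lookup m i) * c)"
proof (cases "lookup m i = 0")
  case False
  from exp_split_unit[OF this] obtain n where "m = n + unit_exp i" ..
  thus ?thesis using partial_single_add_unit[of i n c] by (simp add: lookup_add)
qed (simp add: partial_single_absent)

lemma exp_diff_unit_add:
  assumes "lookup m i \<noteq> 0"
  shows "m - unit_exp i + n = m + n - unit_exp i"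
  using assms by (intro poly_mapping_eqI) (auto simp: lookup_add lookup_minus lookup_single when_def)

lemma partial_mult_single:
  "partial i (single m c * single n d)
     = partial i (single m c) * single n d + single m c * partial i (single n d)"
proof -
  have 1: "single (m - unit_exp i + n) (of_nat (lookup m i) * c * d)
      = single (m + n - unit_exp i) (of_nat (lookup m i) * c * d)"
    using exp_diff_unit_add[of m i n] by (cases "lookup m i = 0") simp_all
  have 2: "single (m + (n - unit_exp i)) (c * (of_nat (lookup n i) * d))
      = single (m + n - unit_exp i) (c * (of_nat (lookup n i) * d))"
    using exp_diff_unit_add[of n i m]
    by (cases "lookup n i = 0") (simp_all add: add.commute)
  show ?thesis
    unfolding partial_single mult_single 1 2
    by (simp add: lookup_add algebra_simps flip: single_add)
qed

lemma partial_mult: "partial i (p * q) = partial i p * q + p * partial i q"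
proof (induction p rule: mpoly_induct)
  case (single m c)
  show ?case
    by (induction q rule: mpoly_induct) (simp_all add: partial_mult_single algebra_simps)
qed (simp_all add: algebra_simps)

lemma partial_Const [simp]: "partial i (Const c) = 0"
  by (simp add: Const_def partial_single_absent)

lemma partial_var: "partial i (var j :: ('n, 'k::comm_ring_1) mpoly) = (if i = j then 1 else 0)"
proof (cases "i = j")
  case True
  have "partial i (var i) = partial i (single (0 + unit_exp i) (1::'k))"
    by (simp add: var_def)
  also have "\<dots> = 1" unfolding partial_single_add_unit by simp
  finally show ?thesis using True by simp
qed (simp add: var_def partial_single_absent lookup_single)

lemma partial_sum: "partial i (\<Sum>j\<in>A. f j) = (\<Sum>j\<in>A. partial i (f j))"
  by (induction A rule: infinite_finite_induct) simp_all

lemma partial_linear_form: "partial i (linear_form c) = Const (c i)"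
  by (simp add: linear_form_alt partial_sum partial_var if_distrib[of "\<lambda>x. _ * x"] cong: if_cong)

lemma partial_power_linear_form:
  "partial i (linear_form c ^ Suc n) = of_nat (Suc n) * Const (c i) * linear_form c ^ n"
  by (induction n) (simp_all add: partial_mult partial_linear_form algebra_simps)

section \<open>Homogeneous polynomials\<close>

definition total_degree :: "('n::finite \<Rightarrow>\<^sub>0 nat) \<Rightarrow> nat"
  where "total_degree m = (\<Sum>i\<in>UNIV. lookup m i)"

lemma total_degree_add: "total_degree (m + n) = total_degree m + total_degree n"
  by (simp add: total_degree_def lookup_add sum.distrib)

lemma total_degree_unit: "total_degree (unit_exp i) = 1"
proof -
  have "total_degree (unit_exp i) = (\<Sum>j\<in>UNIV. if j = i then 1 else 0)"
    unfolding total_degree_def by (intro sum.cong) (auto simp: lookup_single when_def)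
  thus ?thesis by simp
qed

lemma total_degree_single_Suc_0 [simp]: "total_degree (single i (Suc 0)) = 1"
  using total_degree_unit[of i] by simp

lemma total_degree_0 [simp]: "total_degree 0 = 0"
  by (simp add: total_degree_def)

lemma homogeneous_iff:
  "p \<in> homogeneous_part d \<longleftrightarrow> (\<forall>m. lookup p m \<noteq> 0 \<longrightarrow> int (total_degree m) = d)"
  by (auto simp: homogeneous_part_def total_degree_def in_keys_iff)

lemma homogeneous_0 [simp]: "0 \<in> homogeneous_part d"
  by (simp add: homogeneous_iff)

lemma homogeneous_add:
  "p \<in> homogeneous_part d \<Longrightarrow> q \<in> homogeneous_part d \<Longrightarrow> p + q \<in> homogeneous_part d"
  unfolding homogeneous_iff lookup_add by (metis add_0)

lemma homogeneous_diff:
  "p \<in> homogeneous_part d \<Longrightarrow> q \<in> homogeneous_part d \<Longrightarrow> p - q \<in> homogeneous_part d"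
  unfolding homogeneous_iff lookup_minus by (metis diff_self)

lemma homogeneous_sum: "(\<And>i. i \<in> A \<Longrightarrow> f i \<in> homogeneous_part d) \<Longrightarrow> (\<Sum>i\<in>A. f i) \<in> homogeneous_part d"
  by (induction A rule: infinite_finite_induct) (auto intro: homogeneous_add)

lemma homogeneous_mult:
  assumes "p \<in> homogeneous_part d" "q \<in> homogeneous_part e"
  shows "p * q \<in> homogeneous_part (d + e)"
  using assms keys_mult[of p q]
  by (force simp: homogeneous_iff total_degree_add in_keys_iff)

lemma homogeneous_Const [simp]: "Const c \<in> homogeneous_part 0"
  by (auto simp: homogeneous_iff Const_def lookup_single when_def)

lemma homogeneous_1 [simp]: "1 \<in> homogeneous_part 0"
  by (metis Const_1 homogeneous_Const)

lemma homogeneous_Const_times: "p \<in> homogeneous_part d \<Longrightarrow> Const c * p \<in> homogeneous_part d"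
  using homogeneous_mult[OF homogeneous_Const] by fastforce

lemma homogeneous_of_int_times: "p \<in> homogeneous_part d \<Longrightarrow> of_int c * p \<in> homogeneous_part d"
  using homogeneous_Const_times[of p d "of_int c"] by (simp add: Const_of_int)

lemma homogeneous_var [simp]: "var i \<in> homogeneous_part 1"
  by (auto simp: homogeneous_iff var_def lookup_single when_def)

lemma homogeneous_linear_form [simp]: "linear_form c \<in> homogeneous_part 1"
  unfolding linear_form_alt by (intro homogeneous_sum homogeneous_Const_times homogeneous_var)

lemma homogeneous_power:
  assumes "p \<in> homogeneous_part d" shows "p ^ n \<in> homogeneous_part (int n * d)"
proof (induction n)
  case (Suc n)
  have "p * p ^ n \<in> homogeneous_part (d + int n * d)"
    by (rule homogeneous_mult[OF assms Suc])
  thus ?case by (simp add: algebra_simps)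
qed simp

lemma homogeneous_power_linear_form [simp]: "linear_form c ^ n \<in> homogeneous_part (int n)"
  using homogeneous_power[of "linear_form c" 1 n] by simp

lemma homogeneous_partial:
  assumes "p \<in> homogeneous_part d" shows "partial i p \<in> homogeneous_part (d - 1)"
  unfolding homogeneous_iff
proof (intro allI impI)
  fix m assume "lookup (partial i p) m \<noteq> 0"
  hence "lookup p (m + unit_exp i) \<noteq> 0" by (auto simp: lookup_partial)
  with assms have "int (total_degree (m + unit_exp i)) = d"
    unfolding homogeneous_iff by blast
  thus "int (total_degree m) = d - 1" by (simp add: total_degree_add)
qed

lemma homogeneous_negative: "p \<in> homogeneous_part d \<Longrightarrow> d < 0 \<Longrightarrow> p = 0"
  by (rule poly_mapping_eqI) (force simp: homogeneous_iff)

text \<open>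
  Both sides are linear, and on a monomial the left-hand side adds up its exponents.
\<close>

lemma euler_identity:
  assumes "p \<in> homogeneous_part d"
  shows "(\<Sum>i\<in>UNIV. var i * partial i p) = of_int d * p"
proof -
  have *: "(\<Sum>i\<in>UNIV. var i * partial i (single m c)) = of_nat (total_degree m) * single m c" for m c
    by (simp add: var_times_partial_single total_degree_def flip: sum_distrib_right)
  have "p = (\<Sum>m\<in>keys p. single m (lookup p m))"
    by (rule poly_mapping_eqI) (auto simp: lookup_sum lookup_single when_def in_keys_iff)
  hence "(\<Sum>i\<in>UNIV. var i * partial i p)
      = (\<Sum>i\<in>UNIV. \<Sum>m\<in>keys p. var i * partial i (single m (lookup p m)))"
    by (metis (no_types, lifting) partial_sum sum.cong sum_distrib_left)
  also have "\<dots> = (\<Sum>m\<in>keys p. of_nat (total_degree m) * single m (lookup p m))"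
    by (subst sum.swap) (simp add: *)
  also have "\<dots> = (\<Sum>m\<in>keys p. of_int d * single m (lookup p m))"
  proof (rule sum.cong, simp)
    fix m assume "m \<in> keys p"
    hence "int (total_degree m) = d" using assms by (auto simp: homogeneous_iff in_keys_iff)
    thus "of_nat (total_degree m) * single m (lookup p m) = of_int d * single m (lookup p m)"
      by (metis of_int_of_nat_eq)
  qed
  also have "\<dots> = of_int d * p"
    using \<open>p = _\<close> by (simp flip: sum_distrib_left)
  finally show ?thesis .
qed

text \<open>
  Components serve to replace the cofactor in a membership \<open>f - L ^ n * g \<in> J\<close>, with \<open>J\<close>
  spanned by monomials, by a homogeneous one.
\<close>

lift_definition component :: "int \<Rightarrow> ('n::finite, 'k::comm_ring_1) mpoly \<Rightarrow> ('n, 'k) mpoly"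
  is "\<lambda>d p m. if int (total_degree m) = d then p m else 0"
  by (rule rev_finite_subset) auto

lemma lookup_component: "lookup (component d p) m = (if int (total_degree m) = d then lookup p m else 0)"
  by transfer simp

lemma homogeneous_component [simp]: "component d p \<in> homogeneous_part d"
  by (auto simp: homogeneous_iff lookup_component split: if_splits)

lemma component_add: "component d (p + q) = component d p + component d q"
  and component_diff: "component d (p - q) = component d p - component d q"
  by (rule poly_mapping_eqI; simp add: lookup_component lookup_add lookup_minus)+

lemma component_homogeneous: "p \<in> homogeneous_part d \<Longrightarrow> component d p = p"
  by (rule poly_mapping_eqI) (force simp: homogeneous_iff lookup_component)

lemma component_homogeneous_other: "p \<in> homogeneous_part e \<Longrightarrow> e \<noteq> d \<Longrightarrow> component d p = 0"
  by (rule poly_mapping_eqI) (force simp: homogeneous_iff lookup_component)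

lemma single_homogeneous: "single m c \<in> homogeneous_part (int (total_degree m))"
  by (auto simp: homogeneous_iff lookup_single when_def)

lemma component_mult:
  assumes "p \<in> homogeneous_part e"
  shows "component d (p * q) = p * component (d - e) q"
proof (induction q rule: mpoly_induct)
  case zero
  show ?case by (simp add: component_homogeneous_other component_homogeneous)
next
  case (single m c)
  note pm = homogeneous_mult[OF assms single_homogeneous[of m c]]
  show ?case
    using component_homogeneous[OF pm] component_homogeneous_other[OF pm, of d]
      component_homogeneous[OF single_homogeneous[of m c]]
      component_homogeneous_other[OF single_homogeneous[of m c], of "d - e"]
    by (cases "e + int (total_degree m) = d") (auto simp: algebra_simps)
qed (simp_all add: component_add algebra_simps)

section \<open>The monomial complete intersection\<close>

text \<open>
  The ideal generated by the powers \<open>var i ^ a i\<close>, described by its monomials, none of which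
  lies in the box of exponents below \<open>a\<close>. Homogeneous components and the operators below can
  then be tested monomial by monomial.
\<close>

definition box_ideal :: "('n \<Rightarrow> nat) \<Rightarrow> ('n, 'k::comm_ring_1) mpoly set"
  where "box_ideal a = {p. \<forall>m. (\<forall>i. lookup m i < a i) \<longrightarrow> lookup p m = 0}"

lemma box_ideal_0 [simp]: "0 \<in> box_ideal a"
  and box_ideal_add: "p \<in> box_ideal a \<Longrightarrow> q \<in> box_ideal a \<Longrightarrow> p + q \<in> box_ideal a"
  and box_ideal_diff: "p \<in> box_ideal a \<Longrightarrow> q \<in> box_ideal a \<Longrightarrow> p - q \<in> box_ideal a"
  by (simp_all add: box_ideal_def lookup_add lookup_minus)

lemma box_ideal_uminus: "p \<in> box_ideal a \<Longrightarrow> - p \<in> box_ideal a"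
  using box_ideal_diff[OF box_ideal_0] by fastforce

lemma box_ideal_diff_commute: "p - q \<in> box_ideal a \<Longrightarrow> q - p \<in> box_ideal a"
  using box_ideal_uminus[of "p - q" a] by simp

lemma box_ideal_sum: "(\<And>i. i \<in> A \<Longrightarrow> f i \<in> box_ideal a) \<Longrightarrow> (\<Sum>i\<in>A. f i) \<in> box_ideal a"
  by (induction A rule: infinite_finite_induct) (auto intro: box_ideal_add)

lemma box_ideal_single: "a i \<le> lookup m i \<Longrightarrow> single m c \<in> box_ideal a"
  by (auto simp: box_ideal_def lookup_single when_def not_less[symmetric])

lemma box_ideal_induct [consumes 1, case_names zero single add]:
  fixes p :: "('n, 'k::comm_ring_1) mpoly"
  assumes "p \<in> box_ideal a" and "P 0"
    and "\<And>m c i. a i \<le> lookup m i \<Longrightarrow> P (single m c)" and "\<And>p q. P p \<Longrightarrow> P q \<Longrightarrow> P (p + q)"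
  shows "P p"
proof -
  have sum: "P (\<Sum>m\<in>A. single m (lookup p m))" if "A \<subseteq> keys p" for A
    using that
  proof (induction A rule: infinite_finite_induct)
    case (insert m A)
    hence "lookup p m \<noteq> 0" by (simp add: in_keys_iff)
    then obtain i where "a i \<le> lookup m i"
      using assms(1) unfolding box_ideal_def by (force simp: not_less[symmetric])
    thus ?case using insert assms(3,4) by simp
  qed (simp_all add: assms(2))
  have "p = (\<Sum>m\<in>keys p. single m (lookup p m))"
    by (rule poly_mapping_eqI) (auto simp: lookup_sum lookup_single when_def in_keys_iff)
  with sum[of "keys p"] show ?thesis by simp
qed

lemma box_ideal_mult: 
  fixes p q :: "('n, 'k::comm_ring_1) mpoly"
  assumes "p \<in> box_ideal a"
  shows "q * p \<in> box_ideal a"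
  using assms
proof (induction p rule: box_ideal_induct)
  case (single m c i)
  show ?case
  proof (induction q rule: mpoly_induct)
    case (single n d)
    have "a i \<le> lookup (n + m) i" using \<open>a i \<le> lookup m i\<close> by (simp add: lookup_add)
    thus ?case unfolding mult_single by (rule box_ideal_single)
  qed (auto simp: algebra_simps intro: box_ideal_add)
qed (auto simp: algebra_simps intro: box_ideal_add)

lemma of_int_times_Const_inverse:
  assumes "d \<noteq> 0"
  shows "of_int d * Const (inverse (of_int d :: 'k::field_char_0)) = (1 :: ('n, 'k) mpoly)"
proof -
  have "Const (of_int d * inverse (of_int d :: 'k)) = (1 :: ('n, 'k) mpoly)" using assms by simp
  thus ?thesis by (simp only: Const_mult Const_of_int)
qed

lemma box_ideal_of_int_cancel:
  fixes p :: "('n, 'k::field_char_0) mpoly"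
  assumes "of_int d * p \<in> box_ideal a" "d \<noteq> 0"
  shows "p \<in> box_ideal a"
proof -
  have "Const (inverse (of_int d)) * (of_int d * p) = (of_int d * Const (inverse (of_int d :: 'k))) * p"
    by (simp only: mult_ac)
  also have "\<dots> = p" using assms(2) by (simp add: of_int_times_Const_inverse)
  finally show ?thesis using box_ideal_mult[OF assms(1)] by metis
qed

lemma var_power_eq: "(var i ^ n :: ('n, 'k::comm_ring_1) mpoly) = single (single i n) 1"
  by (induction n) (simp_all add: var_def mult_single flip: single_add)

lemma single_eq_var_power_times:
  assumes "a \<le> lookup m i"
  shows "single m c = var i ^ a * single (m - single i a) (c :: 'k::comm_ring_1)"
proof -
  have "m = single i a + (m - single i a)"
    using assms by (intro poly_mapping_eqI) (auto simp: lookup_add lookup_minus lookup_single when_def)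
  thus ?thesis by (simp add: var_power_eq mult_single)
qed

lemma var_power_in_box_ideal: "var i ^ a i \<in> box_ideal a"
  unfolding var_power_eq by (rule box_ideal_single[of _ i]) simp

text \<open>
  The largest degree of a monomial in the box is the sum of all \<open>a i - 1\<close>, the socle degree of
  the quotient.
\<close>

lemma box_ideal_high_degree:
  fixes p :: "('n::finite, 'k::comm_ring_1) mpoly"
  assumes "p \<in> homogeneous_part d" and "d > (\<Sum>i\<in>UNIV. int (a i) - 1)"
  shows "p \<in> box_ideal a"
  unfolding box_ideal_def
proof (intro CollectI allI impI)
  fix m assume "\<forall>i. lookup m i < a i"
  hence "int (total_degree m) \<le> (\<Sum>i\<in>UNIV. int (a i) - 1)"
    unfolding total_degree_def of_nat_sum by (intro sum_mono) (force simp: less_eq_Suc_le)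
  with assms show "lookup p m = 0" by (force simp: homogeneous_iff)
qed

lemma box_ideal_low_degree:
  fixes p :: "('n::finite, 'k::comm_ring_1) mpoly"
  assumes "p \<in> homogeneous_part d" and "\<And>i. d < int (a i)" and "p \<in> box_ideal a"
  shows "p = 0"
proof (rule poly_mapping_eqI)
  fix m :: "'n \<Rightarrow>\<^sub>0 nat"
  have "lookup m i \<le> total_degree m" for i :: 'n
    unfolding total_degree_def by (rule member_le_sum) auto
  hence "lookup m i < a i" if "int (total_degree m) = d" for i
    using assms(2)[of i] that by (metis le_less_trans of_nat_less_iff)
  thus "lookup p m = lookup 0 m"
    using assms(1,3) unfolding homogeneous_iff box_ideal_def by auto
qed

lemma component_box_ideal: "p \<in> box_ideal a \<Longrightarrow> component d p \<in> box_ideal a"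
  by (simp add: box_ideal_def lookup_component)

section \<open>The sl2-action and the strong Lefschetz property\<close>

text \<open>
  On a single variable this operator takes \<open>x ^ j\<close> to \<open>j * (a - j) * x ^ (j - 1)\<close>, up to the
  factor \<open>inverse b\<close>. The coefficient vanishes at \<open>j = a\<close>, so the operator descends to
  polynomials truncated at \<open>x ^ a\<close>. Together with multiplication by \<open>b * x\<close> it gives the
  irreducible sl2-module of dimension \<open>a\<close>; several variables give the tensor product of these.
\<close>

definition lower :: "('n::finite \<Rightarrow> nat) \<Rightarrow> ('n \<Rightarrow> 'k) \<Rightarrow> ('n, 'k::field) mpoly \<Rightarrow> ('n, 'k) mpoly"
  where "lower a b p = (\<Sum>i\<in>UNIV. Const (inverse (b i)) *
           (of_int (int (a i) - 1) * partial i p - var i * partial i (partial i p)))"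

lemma lower_add: "lower a b (p + q) = lower a b p + lower a b q"
  by (simp add: lower_def algebra_simps sum.distrib sum_subtractf)

lemma lower_0 [simp]: "lower a b 0 = 0"
  by (simp add: lower_def)

lemma lower_uminus: "lower a b (- p) = - lower a b p"
  by (metis add.right_inverse add_eq_0_iff lower_0 lower_add)

lemma lower_diff: "lower a b (p - q) = lower a b p - lower a b q"
  by (metis add_uminus_conv_diff lower_add lower_uminus)

lemma homogeneous_lower:
  assumes "p \<in> homogeneous_part d"
  shows "lower a b p \<in> homogeneous_part (d - 1)"
proof -
  have "var i * partial i (partial i p) \<in> homogeneous_part (1 + (d - 1 - 1))" for i
    by (intro homogeneous_mult homogeneous_partial homogeneous_var assms)
  thus ?thesis
    unfolding lower_def
    by (intro homogeneous_sum homogeneous_Const_times homogeneous_diff homogeneous_of_int_times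
      homogeneous_partial assms) simp
qed

text \<open>
  A monomial outside the box enters it only by lowering an exponent from \<open>a i\<close> to
  \<open>a i - 1\<close>, and then its coefficient contains the factor \<open>a i - a i\<close>.
\<close>

lemma lower_box_ideal:
  assumes "p \<in> box_ideal a"
  shows "lower a b p \<in> box_ideal a"
  using assms
proof (induction p rule: box_ideal_induct)
  case (single m c j)
  have "of_int (int (a i) - 1) * partial i (single m c) - var i * partial i (partial i (single m c))
      \<in> box_ideal a" (is "?t i \<in> _") for i
  proof (cases "lookup m i = 0")
    case True
    thus ?thesis by (simp add: partial_single_absent)
  next
    case False
    from exp_split_unit[OF this] obtain n where n: "m = n + unit_exp i" ..
    have t: "?t i = of_int (int (a i) - int (lookup m i)) * partial i (single m c)"
      unfolding n partial_single_add_unit var_times_partial_single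
      by (simp add: lookup_add algebra_simps)
    show ?thesis
    proof (cases "i = j \<and> lookup m j = a j")
      case True
      thus ?thesis unfolding t by simp
    next
      case False
      hence "a j \<le> lookup n j"
        using single n by (auto simp: lookup_add lookup_single when_def split: if_splits)
      thus ?thesis
        unfolding t unfolding n partial_single_add_unit by (intro box_ideal_mult box_ideal_single)
    qed
  qed
  thus ?case unfolding lower_def by (intro box_ideal_sum box_ideal_mult)
qed (auto simp: lower_add intro: box_ideal_add)

text \<open>
  This is the relation \<open>[Y, X] = e - 2 d\<close> of sl2 with \<open>e\<close> the socle degree. The product rule
  leaves \<open>a i - 1\<close> from the first-order part and \<open>- 2 * var i * partial i\<close> from the second-order
  part, and the latter sum up to \<open>- 2 d\<close> by Euler's identity.
\<close>

lemma lower_linear_form_mult: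
  fixes p :: "('n::finite, 'k::field_char_0) mpoly"
  assumes "p \<in> homogeneous_part d" and b: "\<And>i. b i \<noteq> 0"
  shows "lower a b (linear_form b * p)
    = linear_form b * lower a b p + of_int ((\<Sum>i\<in>UNIV. int (a i) - 1) - 2 * d) * p"
proof -
  let ?l = "linear_form b"
  let ?t = "\<lambda>i p. of_int (int (a i) - 1) * partial i p - var i * partial i (partial i p)"
  have "Const (inverse (b i)) * ?t i (?l * p)
      = ?l * (Const (inverse (b i)) * ?t i p)
        + (Const (inverse (b i)) * Const (b i)) * (of_int (int (a i) - 1) * p - 2 * (var i * partial i p))"
    for i
    by (simp add: partial_mult partial_linear_form algebra_simps)
  moreover have "Const (inverse (b i)) * Const (b i) = (1 :: ('n, 'k) mpoly)" for i
    using b[of i] by (simp flip: Const_mult)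
  ultimately have "lower a b (?l * p) = ?l * lower a b p
     + (\<Sum>i\<in>UNIV. of_int (int (a i) - 1) * p - 2 * (var i * partial i p))"
    unfolding lower_def by (simp only: sum.distrib sum_distrib_left mult_1)
  also have "(\<Sum>i\<in>UNIV. of_int (int (a i) - 1) * p - 2 * (var i * partial i p))
      = of_int (\<Sum>i\<in>UNIV. int (a i) - 1) * p - 2 * (of_int d * p)"
    unfolding euler_identity[OF assms(1), symmetric] of_int_sum
    by (simp only: sum_subtractf sum_distrib_left sum_distrib_right)
  finally show ?thesis by (simp add: algebra_simps)
qed

lemma lower_linear_form_power_mult:
  fixes p :: "('n::finite, 'k::field_char_0) mpoly"
  assumes "p \<in> homogeneous_part d" and b: "\<And>i. b i \<noteq> 0"
  shows "lower a b (linear_form b ^ Suc k * p) = linear_form b ^ Suc k * lower a b p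
    + of_int ((int k + 1) * ((\<Sum>i\<in>UNIV. int (a i) - 1) - 2 * d - int k)) * (linear_form b ^ k * p)"
proof (induction k)
  case 0
  show ?case using lower_linear_form_mult[OF assms] by simp
next
  case (Suc k)
  let ?l = "linear_form b" and ?e = "\<Sum>i\<in>UNIV. int (a i) - 1"
  have "?l ^ Suc k * p \<in> homogeneous_part (int (Suc k) + d)"
    by (intro homogeneous_mult homogeneous_power_linear_form assms)
  from lower_linear_form_mult[OF this b]
  have "lower a b (?l ^ Suc (Suc k) * p)
     = ?l * lower a b (?l ^ Suc k * p) + of_int (?e - 2 * (int (Suc k) + d)) * (?l ^ Suc k * p)"
    by (simp only: power_Suc mult.assoc)
  thus ?case unfolding Suc.IH by (simp add: algebra_simps)
qed

text \<open>
  Suppose that \<open>\<ell> ^ (j + 1) * p\<close> vanishes in the quotient. Applying \<open>lower\<close> and multiplying by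
  \<open>\<ell>\<close> gives \<open>\<ell> ^ (j + 2) * lower p = 0\<close>, so \<open>lower p = 0\<close> by induction on the degree. What
  remains of the commutator formula is \<open>c * \<ell> ^ j * p = 0\<close>, and the bound on \<open>d\<close> and \<open>k\<close>
  makes the integer \<open>c\<close> positive, so the exponent can be reduced.
\<close>

lemma lefschetz_injective:
  fixes p :: "('n::finite, 'k::field_char_0) mpoly"
  assumes b: "\<And>i. b i \<noteq> 0"
    and "p \<in> homogeneous_part d" and "2 * d + int k \<le> (\<Sum>i\<in>UNIV. int (a i) - 1)"
    and "linear_form b ^ k * p \<in> box_ideal a"
  shows "p \<in> box_ideal a"
proof -
  let ?l = "linear_form b" and ?e = "\<Sum>i\<in>UNIV. int (a i) - 1"
  \<comment> \<open>The degree is \<open>n - 1\<close>, so that the base case is the zero component of degree \<open>- 1\<close>.\<close>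
  have "p \<in> box_ideal a" if "p \<in> homogeneous_part (int n - 1)" "2 * (int n - 1) + int k \<le> ?e"
    "?l ^ k * p \<in> box_ideal a" for n k and p :: "('n, 'k) mpoly"
    using that
  proof (induction n arbitrary: p k)
    case 0
    thus ?case using homogeneous_negative by fastforce
  next
    case (Suc n p k)
    note IH = Suc.IH
    show ?case using Suc.prems
    proof (induction k)
      case 0
      thus ?case by simp
    next
      case (Suc j)
      define c where "c = (int j + 1) * (?e - 2 * int n - int j)"
      have c: "c \<noteq> 0" using Suc.prems unfolding c_def by auto
      have p: "p \<in> homogeneous_part (int n)" using Suc.prems by simp
      have comm: "lower a b (?l ^ Suc j * p) = ?l ^ Suc j * lower a b p + of_int c * (?l ^ j * p)"
        using lower_linear_form_power_mult[OF p b] unfolding c_def .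
      have Y: "?l ^ Suc j * lower a b p + of_int c * (?l ^ j * p) \<in> box_ideal a"
        unfolding comm[symmetric] by (rule lower_box_ideal) (rule Suc.prems)
      have "?l * (?l ^ Suc j * lower a b p + of_int c * (?l ^ j * p)) - of_int c * (?l ^ Suc j * p)
          \<in> box_ideal a"
        by (intro box_ideal_diff box_ideal_mult Y Suc.prems)
      hence "?l ^ Suc (Suc j) * lower a b p \<in> box_ideal a" by (simp add: algebra_simps)
      moreover have "2 * (int n - 1) + int (Suc (Suc j)) \<le> ?e" using Suc.prems(2) by simp
      ultimately have "lower a b p \<in> box_ideal a"
        using IH[OF homogeneous_lower[OF p]] by blast
      hence "?l ^ Suc j * lower a b p \<in> box_ideal a" by (rule box_ideal_mult)
      with Y have "of_int c * (?l ^ j * p) \<in> box_ideal a"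
        using box_ideal_diff by fastforce
      hence "?l ^ j * p \<in> box_ideal a" using c by (rule box_ideal_of_int_cancel)
      moreover have "2 * (int (Suc n) - 1) + int j \<le> ?e" using Suc.prems(2) by simp
      ultimately show ?case using Suc.IH[OF Suc.prems(1)] by blast
    qed
  qed
  note * = this
  show ?thesis
  proof (cases "d < 0")
    case True
    thus ?thesis using assms(2) homogeneous_negative by fastforce
  next
    case False
    thus ?thesis using *[of p "Suc (nat d)" k] assms by simp
  qed
qed

text \<open>
  Dual to the injectivity argument, by descending induction on the degree. In degree \<open>d + 1\<close>
  there is room for two more powers, so \<open>\<ell> * p = \<ell> ^ (j + 2) * w\<close>. Subtracting
  \<open>\<ell> ^ (j + 1) * w\<close> from \<open>p\<close> leaves an element \<open>\<ell> ^ j * u\<close> that \<open>\<ell>\<close> annihilates.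
  Applying \<open>lower\<close> to \<open>\<ell> ^ (j + 1) * u = 0\<close> expresses a nonzero multiple of \<open>\<ell> ^ j * u\<close> as
  a multiple of \<open>\<ell> ^ (j + 1)\<close>.
\<close>

lemma lefschetz_surjective:
  fixes p :: "('n::finite, 'k::field_char_0) mpoly"
  assumes b: "\<And>i. b i \<noteq> 0"
    and "p \<in> homogeneous_part d" and "2 * d - int k \<ge> (\<Sum>i\<in>UNIV. int (a i) - 1)"
  shows "\<exists>q\<in>homogeneous_part (d - int k). p - linear_form b ^ k * q \<in> box_ideal a"
proof -
  let ?l = "linear_form b" and ?e = "\<Sum>i\<in>UNIV. int (a i) - 1"
  \<comment> \<open>Here \<open>n\<close> counts degrees downwards from \<open>e + 1\<close>, where the quotient is zero.\<close>
  have "\<exists>q\<in>homogeneous_part (?e + 1 - int n - int k). p - ?l ^ k * q \<in> box_ideal a"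
    if "p \<in> homogeneous_part (?e + 1 - int n)" "2 * (?e + 1 - int n) - int k \<ge> ?e"
    for n k and p :: "('n, 'k) mpoly"
    using that
  proof (induction n arbitrary: p k)
    case 0
    hence "p \<in> box_ideal a" by (intro box_ideal_high_degree) auto
    thus ?case by (intro bexI[of _ 0]) auto
  next
    case (Suc n p k)
    define d where "d = ?e + 1 - int (Suc n)"
    note IH = Suc.IH
    show ?case using Suc.prems unfolding d_def[symmetric]
    proof (induction k)
      case 0
      thus ?case by (intro bexI[of _ p]) auto
    next
      case (Suc j)
      define c where "c = (int j + 1) * (?e - 2 * (d - int j) - int j)"
      have c: "c \<noteq> 0" using Suc.prems unfolding c_def by auto
      obtain v where v: "v \<in> homogeneous_part (d - int j)" "p - ?l ^ j * v \<in> box_ideal a"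
        using Suc by auto
      have "?l * p \<in> homogeneous_part (1 + d)"
        by (intro homogeneous_mult homogeneous_linear_form Suc.prems)
      hence "\<exists>w\<in>homogeneous_part (?e + 1 - int n - int (Suc (Suc j))).
          ?l * p - ?l ^ Suc (Suc j) * w \<in> box_ideal a"
        using Suc.prems by (intro IH) (simp_all add: d_def algebra_simps)
      then obtain w where w: "w \<in> homogeneous_part (d - int (Suc j))"
        "?l * p - ?l ^ Suc (Suc j) * w \<in> box_ideal a"
        by (auto simp: d_def algebra_simps)
      define u where "u = v - ?l * w"
      have "?l * w \<in> homogeneous_part (1 + (d - int (Suc j)))"
        by (intro homogeneous_mult homogeneous_linear_form w)
      hence u: "u \<in> homogeneous_part (d - int j)"
        unfolding u_def using v by (intro homogeneous_diff) (simp_all add: algebra_simps)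
      have pu: "p - ?l ^ Suc j * w - ?l ^ j * u \<in> box_ideal a"
        using v(2) by (simp add: u_def algebra_simps)
      have "?l * p - ?l ^ Suc (Suc j) * w - ?l * (p - ?l ^ Suc j * w - ?l ^ j * u) \<in> box_ideal a"
        by (intro box_ideal_diff box_ideal_mult pu w)
      hence "?l ^ Suc j * u \<in> box_ideal a" by (simp add: algebra_simps)
      hence "lower a b (?l ^ Suc j * u) \<in> box_ideal a" by (rule lower_box_ideal)
      hence Y: "?l ^ Suc j * lower a b u + of_int c * (?l ^ j * u) \<in> box_ideal a"
        unfolding lower_linear_form_power_mult[OF u b] c_def .
      define z where "z = w - Const (inverse (of_int c)) * lower a b u"
      have "lower a b u \<in> homogeneous_part (d - int (Suc j))"
        using homogeneous_lower[OF u] by (simp add: algebra_simps)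
      hence z: "z \<in> homogeneous_part (d - int (Suc j))"
        unfolding z_def by (intro homogeneous_diff homogeneous_Const_times w)
      have "of_int c * (p - ?l ^ Suc j * z) = of_int c * (p - ?l ^ Suc j * w)
          + ?l ^ Suc j * ((of_int c * Const (inverse (of_int c))) * lower a b u)"
        unfolding z_def by (simp add: algebra_simps)
      also have "\<dots> = of_int c * (p - ?l ^ Suc j * w) + ?l ^ Suc j * lower a b u"
        by (simp only: of_int_times_Const_inverse[OF c] mult_1)
      also have "\<dots> = of_int c * (p - ?l ^ Suc j * w - ?l ^ j * u)
          + (?l ^ Suc j * lower a b u + of_int c * (?l ^ j * u))"
        by (simp add: algebra_simps)
      finally have "of_int c * (p - ?l ^ Suc j * z) = \<dots>" .
      hence "of_int c * (p - ?l ^ Suc j * z) \<in> box_ideal a"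
        by (metis pu Y box_ideal_add box_ideal_mult)
      hence "p - ?l ^ Suc j * z \<in> box_ideal a" using c by (rule box_ideal_of_int_cancel)
      with z show ?case by blast
    qed
  qed
  note * = this
  show ?thesis
  proof (cases "d > ?e")
    case True
    hence "p \<in> box_ideal a" using assms(2) by (intro box_ideal_high_degree)
    thus ?thesis by (intro bexI[of _ 0]) auto
  next
    case False
    thus ?thesis using *[of p "nat (?e + 1 - d)" k] assms by simp
  qed
qed

section \<open>Apolarity\<close>

definition monomial_fact :: "('n::finite \<Rightarrow>\<^sub>0 nat) \<Rightarrow> 'k::comm_ring_1"
  where "monomial_fact m = (\<Prod>i\<in>UNIV. of_nat (fact (lookup m i)))"

lemma monomial_fact_nonzero: "(monomial_fact m :: 'k::field_char_0) \<noteq> 0"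
  by (simp add: monomial_fact_def)

lemma monomial_fact_add_unit:
  "monomial_fact (m + unit_exp i) = (of_nat (Suc (lookup m i)) * monomial_fact m :: 'k::comm_ring_1)"
proof -
  have *: "(of_nat (fact (lookup (m + unit_exp i) j)) :: 'k)
      = (if j = i then of_nat (Suc (lookup m i)) else 1) * of_nat (fact (lookup m j))" for j
    by (simp add: lookup_add lookup_single when_def algebra_simps)
  show ?thesis
    unfolding monomial_fact_def * prod.distrib by simp
qed

text \<open>
  The factorials make multiplication by a variable adjoint to the partial derivative with
  respect to it.
\<close>

definition apolar :: "('n::finite, 'k::comm_ring_1) mpoly \<Rightarrow> ('n, 'k) mpoly \<Rightarrow> 'k"
  where "apolar p F = (\<Sum>m\<in>keys p. lookup p m * (monomial_fact m * lookup F m))"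

lemma apolar_add: "apolar (p + q) F = apolar p F + apolar q F"
  unfolding apolar_def by (rule setsum_keys_plus_distrib) (simp_all add: algebra_simps)

lemma apolar_0 [simp]: "apolar 0 F = 0"
  by (simp add: apolar_def)

lemma apolar_0_right [simp]: "apolar p 0 = 0"
  by (simp add: apolar_def)

lemma apolar_uminus: "apolar (- p) F = - apolar p F"
  by (metis add.right_inverse add_eq_0_iff apolar_0 apolar_add)

lemma apolar_diff: "apolar (p - q) F = apolar p F - apolar q F"
  by (metis add_uminus_conv_diff apolar_add apolar_uminus)

lemma apolar_sum: "apolar (\<Sum>i\<in>A. f i) F = (\<Sum>i\<in>A. apolar (f i) F)"
  by (induction A rule: infinite_finite_induct) (simp_all add: apolar_add)

lemma apolar_single: "apolar (single m x) F = x * (monomial_fact m * lookup F m)"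
  by (cases "x = 0") (simp_all add: apolar_def)

lemma apolar_Const_times: "apolar (Const x * p) F = x * apolar p F"
  by (induction p rule: mpoly_induct)
    (simp_all add: Const_def mult_single apolar_single apolar_add algebra_simps)

lemma apolar_sum_right: "apolar p (\<Sum>i\<in>A. f i) = (\<Sum>i\<in>A. apolar p (f i))"
  unfolding apolar_def lookup_sum sum_distrib_left by (rule sum.swap)

lemma apolar_Const_times_right: "apolar p (Const x * F) = x * apolar p F"
  by (simp add: apolar_def lookup_Const_times sum_distrib_left mult.left_commute)

lemma apolar_var_times: "apolar (var i * p) F = apolar p (partial i F)"
proof (induction p rule: mpoly_induct)
  case (single m x)
  show ?case
    unfolding var_times_single apolar_single monomial_fact_add_unit lookup_partial
    by (simp only: mult_ac)
qed (simp_all add: apolar_add algebra_simps)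

lemma apolar_var_power_times: "apolar (var i ^ n * p) F = apolar p ((partial i ^^ n) F)"
  by (induction n arbitrary: F) (simp_all add: apolar_var_times mult.assoc funpow_swap1)

definition dir_deriv :: "('n::finite \<Rightarrow> 'k) \<Rightarrow> ('n, 'k::comm_ring_1) mpoly \<Rightarrow> ('n, 'k) mpoly"
  where "dir_deriv v p = (\<Sum>i\<in>UNIV. Const (v i) * partial i p)"

lemma dir_deriv_0 [simp]: "dir_deriv v 0 = 0"
  and dir_deriv_add [simp]: "dir_deriv v (p + q) = dir_deriv v p + dir_deriv v q"
  and dir_deriv_diff [simp]: "dir_deriv v (p - q) = dir_deriv v p - dir_deriv v q"
  and dir_deriv_Const [simp]: "dir_deriv v (Const x) = 0"
  by (simp_all add: dir_deriv_def algebra_simps sum.distrib sum_subtractf)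

lemma dir_deriv_mult: "dir_deriv v (p * q) = dir_deriv v p * q + p * dir_deriv v q"
  by (simp add: dir_deriv_def partial_mult algebra_simps sum.distrib sum_distrib_left)

lemma dir_deriv_1 [simp]: "dir_deriv v 1 = 0"
  by (metis Const_1 dir_deriv_Const)

lemma dir_deriv_Const_times [simp]: "dir_deriv v (Const x * p) = Const x * dir_deriv v p"
  by (simp add: dir_deriv_mult)

lemma dir_deriv_var [simp]: "dir_deriv v (var i) = Const (v i)"
  by (simp add: dir_deriv_def partial_var if_distrib[of "\<lambda>x. _ * x"] cong: if_cong)

lemma dir_deriv_unit: "dir_deriv (\<lambda>j. if j = i then 1 else 0) p = partial i p"
  by (simp add: dir_deriv_def if_distrib[of Const] if_distrib[of "\<lambda>x. x * _"] cong: if_cong)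

lemma homogeneous_dir_deriv: "p \<in> homogeneous_part d \<Longrightarrow> dir_deriv v p \<in> homogeneous_part (d - 1)"
  unfolding dir_deriv_def by (intro homogeneous_sum homogeneous_Const_times homogeneous_partial)

lemma apolar_linear_form_times: "apolar (linear_form v * p) F = apolar p (dir_deriv v F)"
  by (simp add: linear_form_alt dir_deriv_def sum_distrib_right apolar_sum apolar_sum_right
      mult.assoc apolar_Const_times apolar_Const_times_right apolar_var_times)

lemma apolar_linear_form_power_times:
  "apolar (linear_form v ^ n * p) F = apolar p ((dir_deriv v ^^ n) F)"
  by (induction n arbitrary: F) (simp_all add: apolar_linear_form_times mult.assoc funpow_swap1)

lemma eval_dir_deriv_self:
  assumes "p \<in> homogeneous_part d"
  shows "eval_mpoly c (dir_deriv c p) = of_int d * eval_mpoly c p"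
proof -
  have "eval_mpoly c (dir_deriv c p) = eval_mpoly c (\<Sum>i\<in>UNIV. var i * partial i p)"
    by (simp add: dir_deriv_def)
  also have "\<dots> = eval_mpoly c (Const (of_int d) * p)"
    unfolding euler_identity[OF assms] Const_of_int ..
  finally show ?thesis by simp
qed

lemma homogeneous_0_eq_Const:
  fixes p :: "('n::finite, 'k::comm_ring_1) mpoly"
  assumes "p \<in> homogeneous_part 0"
  shows "p = Const (lookup p 0)"
proof (rule poly_mapping_eqI)
  fix m :: "'n \<Rightarrow>\<^sub>0 nat"
  have "m = 0" if "total_degree m = 0"
    using that by (intro poly_mapping_eqI) (simp add: total_degree_def)
  thus "lookup p m = lookup (Const (lookup p 0)) m"
    using assms by (auto simp: homogeneous_iff Const_def lookup_single when_def)
qed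

text \<open>
  Pairing with the power of a linear form is evaluation at its coefficient vector: the \<open>d\<close>
  derivatives along \<open>c\<close> each contribute a factor by Euler's identity at the point \<open>c\<close>.
\<close>

lemma apolar_linear_form_power:
  assumes "F \<in> homogeneous_part (int d)"
  shows "apolar (linear_form c ^ d) F = fact d * eval_mpoly c F"
proof -
  have "apolar (linear_form c ^ d * 1) F = fact d * eval_mpoly c F"
    using assms
  proof (induction d arbitrary: F)
    case 0
    have "apolar 1 F = lookup F 0"
      using apolar_single[of 0 1 F] by (simp add: monomial_fact_def)
    thus ?case using homogeneous_0_eq_Const[of F] 0 eval_Const[of c "lookup F 0"] by simp
  next
    case (Suc d)
    have h: "dir_deriv c F \<in> homogeneous_part (int d)"
      using homogeneous_dir_deriv[OF Suc.prems, of c] by simp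
    show ?case
      using Suc.IH[OF h] eval_dir_deriv_self[OF Suc.prems, of c]
      by (simp add: mult.assoc apolar_linear_form_times algebra_simps)
  qed
  thus ?thesis by simp
qed

text \<open>
  In characteristic zero this says that \<open>p\<close>, restricted to any line in the direction \<open>v\<close>, has
  degree at most \<open>d\<close>. Stated through the iterated derivation, it is additive over products by
  the product rule alone.
\<close>

definition order_le :: "('n::finite \<Rightarrow> 'k) \<Rightarrow> nat \<Rightarrow> ('n, 'k::comm_ring_1) mpoly \<Rightarrow> bool"
  where "order_le v d p \<longleftrightarrow> (dir_deriv v ^^ Suc d) p = 0"

lemma funpow_dir_deriv_0: "(dir_deriv v ^^ n) 0 = 0"
  by (induction n) simp_all

lemma funpow_dir_deriv_add: "(dir_deriv v ^^ n) (p + q) = (dir_deriv v ^^ n) p + (dir_deriv v ^^ n) q"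
  by (induction n) simp_all

lemma funpow_dir_deriv_diff: "(dir_deriv v ^^ n) (p - q) = (dir_deriv v ^^ n) p - (dir_deriv v ^^ n) q"
  by (induction n) simp_all

lemma order_le_Suc: "order_le v (Suc d) p \<longleftrightarrow> order_le v d (dir_deriv v p)"
  unfolding order_le_def by (simp only: funpow_Suc_right o_apply)

lemma order_le_zero: "order_le v 0 p \<longleftrightarrow> dir_deriv v p = 0"
  by (simp add: order_le_def)

lemma order_le_0 [simp]: "order_le v d 0"
  by (simp add: order_le_def funpow_dir_deriv_0)

lemma order_le_add: "order_le v d p \<Longrightarrow> order_le v d q \<Longrightarrow> order_le v d (p + q)"
  and order_le_diff: "order_le v d p \<Longrightarrow> order_le v d q \<Longrightarrow> order_le v d (p - q)"
  unfolding order_le_def funpow_dir_deriv_add funpow_dir_deriv_diff by simp_all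

lemma order_le_mult:
  assumes "order_le v d p" "order_le v e q"
  shows "order_le v (d + e) (p * q)"
  using assms
proof (induction "d + e" arbitrary: d e p q)
  case 0
  thus ?case by (simp add: order_le_zero dir_deriv_mult)
next
  case (Suc n)
  have 1: "order_le v n (dir_deriv v p * q)"
  proof (cases d)
    case 0
    thus ?thesis using Suc.prems by (simp add: order_le_zero)
  next
    case (Suc d')
    thus ?thesis using Suc.hyps(1)[of d' e "dir_deriv v p" q] Suc.prems \<open>Suc n = d + e\<close>
      by (simp add: order_le_Suc)
  qed
  have 2: "order_le v n (p * dir_deriv v q)"
  proof (cases e)
    case 0
    thus ?thesis using Suc.prems by (simp add: order_le_zero)
  next
    case (Suc e')
    thus ?thesis using Suc.hyps(1)[of d e' p "dir_deriv v q"] Suc.prems \<open>Suc n = d + e\<close>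
      by (simp add: order_le_Suc)
  qed
  show ?case
    unfolding \<open>Suc n = d + e\<close>[symmetric] order_le_Suc dir_deriv_mult by (intro order_le_add 1 2)
qed

lemma order_le_Const_times: "order_le v d p \<Longrightarrow> order_le v d (Const x * p)"
  using order_le_mult[of v 0 "Const x" d p] by (simp add: order_le_zero)

lemma order_le_power: "order_le v d p \<Longrightarrow> order_le v (n * d) (p ^ n)"
proof (induction n)
  case (Suc n)
  thus ?case using order_le_mult[of v d p "n * d" "p ^ n"] by simp
qed (simp add: order_le_zero)

section \<open>Invariant forms\<close>

text \<open>
  Differences of the rescaled coordinates \<open>var i / b i\<close>: the linear forms that are invariant
  under translation along \<open>b\<close>.
\<close>

definition diff_form :: "('n \<Rightarrow> 'k) \<Rightarrow> 'n \<Rightarrow> 'n \<Rightarrow> ('n, 'k::field) mpoly"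
  where "diff_form b i j = Const (inverse (b i)) * var i - Const (inverse (b j)) * var j"

lemma nonzero_if_eval_nonzero: "eval_mpoly c p \<noteq> 0 \<Longrightarrow> p \<noteq> 0"
  by auto

lemma homogeneous_diff_form: "diff_form b i j \<in> homogeneous_part 1"
  unfolding diff_form_def by (intro homogeneous_diff homogeneous_Const_times homogeneous_var)

lemma eval_diff_form: "eval_mpoly c (diff_form b i j) = c i / b i - c j / b j"
  by (simp add: diff_form_def field_simps)

lemma dir_deriv_diff_form: "dir_deriv v (diff_form b i j) = Const (v i / b i - v j / b j)"
  by (simp add: diff_form_def Const_diff Const_mult field_class.field_divide_inverse mult.commute[of "Const (v _)"])

lemma order_le_diff_form:
  "order_le v (Suc 0) (diff_form b i j)"
  "v i / b i = v j / b j \<Longrightarrow> order_le v 0 (diff_form b i j)"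
  by (simp_all add: order_le_def dir_deriv_diff_form)

lemma order_le_diff_form_unit:
  assumes "i \<noteq> k" "j \<noteq> k"
  shows "order_le (\<lambda>l. if l = k then 1 else 0) 0 (diff_form b i j)"
  using assms by (simp add: order_le_def dir_deriv_diff_form)

lemma distinct_indices: "(1::4) \<noteq> 2" "(1::4) \<noteq> 3" "(1::4) \<noteq> 4" "(2::4) \<noteq> 3" "(2::4) \<noteq> 4" "(3::4) \<noteq> 4"
  by simp_all

lemma UNIV_4: "(UNIV :: 4 set) = {1, 2, 3, 4}"
proof -
  have "card {1, 2, 3, 4 :: 4} = CARD(4)" using distinct_indices by simp
  thus ?thesis by (metis card_subset_eq finite subset_UNIV)
qed


text \<open>
  The pencil of translation invariant quadrics that have degree at most one in each variable.
  After dividing out the direction \<open>b\<close> these are the conics through the images of the four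
  coordinate points.
\<close>

definition conic :: "(4 \<Rightarrow> 'k) \<Rightarrow> 'k \<Rightarrow> 'k \<Rightarrow> (4, 'k::field) mpoly"
  where "conic b x y = Const x * (diff_form b 1 2 * diff_form b 3 4)
                     - Const y * (diff_form b 1 3 * diff_form b 2 4)"

lemma homogeneous_conic: "conic b x y \<in> homogeneous_part 2"
proof -
  have "diff_form b i j * diff_form b k l \<in> homogeneous_part (1 + 1)" for i j k l
    by (intro homogeneous_mult homogeneous_diff_form)
  thus ?thesis
    unfolding conic_def by (intro homogeneous_diff homogeneous_Const_times) simp_all
qed

lemma order_le_conic: "order_le v 2 (conic b x y)"
proof -
  have "order_le v (Suc 0 + Suc 0) (diff_form b i j * diff_form b k l)" for i j k l
    by (intro order_le_mult order_le_diff_form)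
  thus ?thesis
    unfolding conic_def by (intro order_le_diff order_le_Const_times) (simp_all add: numeral_2_eq_2)
qed

lemma order_le_conic_unit: "order_le (\<lambda>l. if l = k then 1 else 0) (Suc 0) (conic b x y)"
proof -
  let ?v = "\<lambda>l. if l = k then 1 else 0"
  have *: "order_le ?v (Suc 0) (diff_form b i j * diff_form b i' j')"
    if "(i \<noteq> k \<and> j \<noteq> k) \<or> (i' \<noteq> k \<and> j' \<noteq> k)" for i j i' j'
    using that
  proof
    assume "i \<noteq> k \<and> j \<noteq> k"
    thus ?thesis
      using order_le_mult[OF order_le_diff_form_unit[of i k j b] order_le_diff_form(1)[of ?v b i' j']]
      by simp
  next
    assume "i' \<noteq> k \<and> j' \<noteq> k"
    thus ?thesis
      using order_le_mult[OF order_le_diff_form(1)[of ?v b i j] order_le_diff_form_unit[of i' k j' b]]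
      by simp
  qed
  have "k = 1 \<or> k = 2 \<or> k = 3 \<or> k = 4" using UNIV_4 by blast
  thus ?thesis
    unfolding conic_def using distinct_indices
    by (intro order_le_diff order_le_Const_times *) auto
qed

text \<open>
  The coefficients are chosen so that the conic vanishes at \<open>v\<close>: up to a factor two its value
  there is the second derivative along \<open>v\<close>, in which the two products of differences cancel.
\<close>

lemma order_le_conic_through_point:
  assumes "v 1 / b 1 = t 1" "v 2 / b 2 = t 2" "v 3 / b 3 = t 3" "v 4 / b 4 = t 4"
  shows "order_le v (Suc 0) (conic b ((t 1 - t 3) * (t 2 - t 4)) ((t 1 - t 2) * (t 3 - t 4)))"
  by (simp add: order_le_def conic_def dir_deriv_mult dir_deriv_diff_form assms
      flip: Const_mult Const_add Const_diff)

lemma order_le_conic_invariant: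
  assumes "\<And>i. b i \<noteq> 0"
  shows "order_le b 0 (conic b x y)"
  using assms by (simp add: order_le_def conic_def dir_deriv_mult dir_deriv_diff_form)

text \<open>
  The form is a product of \<open>p\<close>, \<open>q\<close>, \<open>r\<close>, \<open>s\<close> copies of the differences with indices 34, 24, 23
  and 14, of \<open>k\<close> copies of the conic \<open>Q0\<close> through \<open>c\<close> and of \<open>n\<close> copies of another conic \<open>Q1\<close>.
  A difference has degree one along each of its two variables, a conic has degree one along
  every variable, and along \<open>c\<close> the conic \<open>Q1\<close> has degree two but \<open>Q0\<close> only degree one.
\<close>

lemma exists_invariant_form:
  fixes b c :: "4 \<Rightarrow> 'k::field_char_0"
  assumes b: "\<And>i. b i \<noteq> 0" and t: "\<And>i j. i \<noteq> j \<Longrightarrow> c i / b i \<noteq> c j / b j"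
  shows "\<exists>F\<in>homogeneous_part (int (p + q + r + s + 2 * k + 2 * n)).
    F \<noteq> 0 \<and> dir_deriv b F = 0 \<and>
    (partial 1 ^^ Suc (s + k + n)) F = 0 \<and>
    (partial 2 ^^ Suc (q + r + k + n)) F = 0 \<and>
    (partial 3 ^^ Suc (p + r + k + n)) F = 0 \<and>
    (partial 4 ^^ Suc (p + q + s + k + n)) F = 0 \<and>
    (dir_deriv c ^^ Suc (p + q + r + s + k + 2 * n)) F = 0 \<and>
    (k = 0 \<longrightarrow> eval_mpoly c F \<noteq> 0)"
proof -
  define t where "t i = c i / b i" for i
  define Q0 where "Q0 = conic b ((t 1 - t 3) * (t 2 - t 4)) ((t 1 - t 2) * (t 3 - t 4))"
  define Q1 where "Q1 = conic b 1 0"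
  define F where "F = diff_form b 3 4 ^ p * diff_form b 2 4 ^ q * diff_form b 2 3 ^ r
    * diff_form b 1 4 ^ s * Q0 ^ k * Q1 ^ n"
  have t': "t i \<noteq> t j" if "i \<noteq> j" for i j using t that by (simp add: t_def)
  have order: "order_le v (p * d1 + q * d2 + r * d3 + s * d4 + k * d5 + n * d6) F"
    if "order_le v d1 (diff_form b 3 4)" "order_le v d2 (diff_form b 2 4)"
      "order_le v d3 (diff_form b 2 3)" "order_le v d4 (diff_form b 1 4)"
      "order_le v d5 Q0" "order_le v d6 Q1" for v d1 d2 d3 d4 d5 d6
    unfolding F_def by (intro order_le_mult order_le_power that)
  have partial: "(partial i ^^ Suc d) F = 0" if "order_le (\<lambda>j. if j = i then 1 else 0) d F" for i d
    using that unfolding order_le_def dir_deriv_unit .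
  have F: "F \<in> homogeneous_part
     (int p * 1 + int q * 1 + int r * 1 + int s * 1 + int k * 2 + int n * 2)"
    unfolding F_def Q0_def Q1_def
    by (intro homogeneous_mult homogeneous_power homogeneous_diff_form homogeneous_conic)
  have "int p * 1 + int q * 1 + int r * 1 + int s * 1 + int k * 2 + int n * 2
      = int (p + q + r + s + 2 * k + 2 * n)" by simp
  with F have "F \<in> homogeneous_part (int (p + q + r + s + 2 * k + 2 * n))" by (simp only:)
  moreover have "F \<noteq> 0"
  proof -
    have "eval_mpoly c (diff_form b i j) \<noteq> 0" if "i \<noteq> j" for i j
      using t that by (simp add: eval_diff_form)
    hence d: "diff_form b i j \<noteq> 0" if "i \<noteq> j" for i j
      using that nonzero_if_eval_nonzero by blast
    have "eval_mpoly c Q1 \<noteq> 0" using t by (simp add: Q1_def conic_def eval_diff_form)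
    hence Q1: "Q1 \<noteq> 0" by (rule nonzero_if_eval_nonzero)
    \<comment> \<open>At this point the rescaled coordinates are 0, 1, 0, 2, so the difference 13 vanishes.\<close>
    have "eval_mpoly (\<lambda>i. (if i = 2 then 1 else if i = 4 then 2 else 0) * b i) Q0 \<noteq> 0"
      using b t' by (simp add: Q0_def conic_def eval_diff_form)
    hence Q0: "Q0 \<noteq> 0" by (rule nonzero_if_eval_nonzero)
    show ?thesis unfolding F_def using d Q0 Q1 by simp
  qed
  moreover have "dir_deriv b F = 0"
  proof -
    have "order_le b (p * 0 + q * 0 + r * 0 + s * 0 + k * 0 + n * 0) F"
      by (intro order) (simp_all add: Q0_def Q1_def b order_le_diff_form order_le_conic_invariant)
    thus ?thesis by (simp add: order_le_zero)
  qed
  moreover have "(partial 1 ^^ Suc (s + k + n)) F = 0"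
    using order[of "\<lambda>j. if j = 1 then 1 else 0" 0 0 0 1 1 1] unfolding Q0_def Q1_def
    by (intro partial) (simp add: order_le_diff_form(1) order_le_diff_form_unit order_le_conic_unit)
  moreover have "(partial 2 ^^ Suc (q + r + k + n)) F = 0"
    using order[of "\<lambda>j. if j = 2 then 1 else 0" 0 1 1 0 1 1] unfolding Q0_def Q1_def
    by (intro partial) (simp add: order_le_diff_form(1) order_le_diff_form_unit order_le_conic_unit)
  moreover have "(partial 3 ^^ Suc (p + r + k + n)) F = 0"
    using order[of "\<lambda>j. if j = 3 then 1 else 0" 1 0 1 0 1 1] unfolding Q0_def Q1_def
    by (intro partial) (simp add: order_le_diff_form(1) order_le_diff_form_unit order_le_conic_unit)
  moreover have "(partial 4 ^^ Suc (p + q + s + k + n)) F = 0"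
    using order[of "\<lambda>j. if j = 4 then 1 else 0" 1 1 0 1 1 1] unfolding Q0_def Q1_def
    by (intro partial) (simp add: order_le_diff_form(1) order_le_diff_form_unit order_le_conic_unit)
  moreover have "(dir_deriv c ^^ Suc (p + q + r + s + k + 2 * n)) F = 0"
  proof -
    have "order_le c (Suc 0) Q0"
      unfolding Q0_def by (intro order_le_conic_through_point) (simp_all add: t_def)
    hence "order_le c (p * Suc 0 + q * Suc 0 + r * Suc 0 + s * Suc 0 + k * Suc 0 + n * 2) F"
      by (intro order) (simp_all add: Q1_def order_le_diff_form(1) order_le_conic)
    thus ?thesis by (simp add: order_le_def mult.commute del: funpow.simps)
  qed
  moreover have "eval_mpoly c F \<noteq> 0" if "k = 0"
    using that t by (simp add: F_def Q1_def conic_def eval_diff_form)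
  ultimately show ?thesis by blast
qed

section \<open>The ideal of powers and its quotient\<close>

lemma mpoly_ring_simps:
  "carrier mpoly_ring = UNIV" "x \<otimes>\<^bsub>mpoly_ring\<^esub> y = x * y" "x \<oplus>\<^bsub>mpoly_ring\<^esub> y = x + y"
  "\<one>\<^bsub>mpoly_ring\<^esub> = 1" "\<zero>\<^bsub>mpoly_ring\<^esub> = 0"
  by (simp_all add: ring_of_type_algebra_def)

lemma cring_mpoly_ring: "cring (mpoly_ring :: ('n, 'k::comm_ring_1) mpoly ring)"
  by (rule cring_from_type_algebra)

lemma idealI_mpoly:
  fixes I :: "('n, 'k::comm_ring_1) mpoly set"
  assumes "0 \<in> I" "\<And>x y. x \<in> I \<Longrightarrow> y \<in> I \<Longrightarrow> x + y \<in> I" "\<And>x y. x \<in> I \<Longrightarrow> y * x \<in> I"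
  shows "ideal I mpoly_ring"
proof -
  interpret R: cring "mpoly_ring :: ('n, 'k) mpoly ring" by (rule cring_mpoly_ring)
  have inv: "\<ominus>\<^bsub>mpoly_ring\<^esub> x = - x" for x :: "('n, 'k) mpoly"
    using R.r_neg[of x] R.minus_unique[of x "- x"]
    by (metis R.minus_equality UNIV_I add.left_inverse mpoly_ring_simps(1,3,5))
  have neg: "- x \<in> I" if "x \<in> I" for x using assms(3)[OF that, of "- 1"] by simp
  have "subgroup I (add_monoid mpoly_ring)"
    by (rule R.add.subgroupI)
      (use assms neg in \<open>auto simp: mpoly_ring_simps inv a_inv_def[symmetric]\<close>)
  thus ?thesis
    by (rule idealI[OF R.ring_axioms])
      (use assms(3) in \<open>auto simp: mpoly_ring_simps mult.commute\<close>)
qed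

lemma ideal_mpolyD:
  fixes I :: "('n, 'k::comm_ring_1) mpoly set"
  assumes "ideal I mpoly_ring"
  shows "0 \<in> I" "x \<in> I \<Longrightarrow> y \<in> I \<Longrightarrow> x + y \<in> I" "x \<in> I \<Longrightarrow> y * x \<in> I"
proof -
  interpret ideal I "mpoly_ring :: ('n, 'k) mpoly ring" by (rule assms)
  show "0 \<in> I"
    using additive_subgroup.zero_closed[OF ideal.axioms(1)[OF assms]] by (simp add: mpoly_ring_simps)
  show "x \<in> I \<Longrightarrow> y \<in> I \<Longrightarrow> x + y \<in> I" 
    using additive_subgroup.a_closed[OF ideal.axioms(1)[OF assms], of x y]
    by (simp add: mpoly_ring_simps)
  show "x \<in> I \<Longrightarrow> y * x \<in> I" using I_l_closed[of x y] by (simp add: mpoly_ring_simps)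
qed

text \<open>
  The ideal generated by the powers of the variables together with \<open>L ^ n\<close>, see
  \<open>genideal_powers\<close>. In this form a membership is a single congruence modulo the monomial ideal.
\<close>

definition powers_ideal :: "('n \<Rightarrow> nat) \<Rightarrow> ('n, 'k) mpoly \<Rightarrow> nat \<Rightarrow> ('n, 'k::comm_ring_1) mpoly set"
  where "powers_ideal a L n = {f. \<exists>g. f - L ^ n * g \<in> box_ideal a}"

lemma ideal_powers_ideal:
  fixes L :: "('n, 'k::comm_ring_1) mpoly"
  shows "ideal (powers_ideal a L n) mpoly_ring"
proof (rule idealI_mpoly)
  show "0 \<in> powers_ideal a L n" unfolding powers_ideal_def by (auto intro: exI[of _ 0])
next
  fix x y assume "x \<in> powers_ideal a L n" "y \<in> powers_ideal a L n"
  then obtain g h where "x - L ^ n * g \<in> box_ideal a" "y - L ^ n * h \<in> box_ideal a"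
    by (auto simp: powers_ideal_def)
  hence "(x - L ^ n * g) + (y - L ^ n * h) \<in> box_ideal a" by (rule box_ideal_add)
  hence "x + y - L ^ n * (g + h) \<in> box_ideal a" by (simp add: algebra_simps)
  thus "x + y \<in> powers_ideal a L n" by (auto simp: powers_ideal_def)
next
  fix x y assume "x \<in> powers_ideal a L n"
  then obtain g where "x - L ^ n * g \<in> box_ideal a" by (auto simp: powers_ideal_def)
  hence "y * (x - L ^ n * g) \<in> box_ideal a" by (rule box_ideal_mult)
  hence "y * x - L ^ n * (y * g) \<in> box_ideal a" by (simp add: algebra_simps)
  thus "y * x \<in> powers_ideal a L n" by (auto simp: powers_ideal_def)
qed

lemma genideal_powers:
  fixes L :: "('n, 'k::comm_ring_1) mpoly"
  shows "Idl\<^bsub>mpoly_ring\<^esub> (insert (L ^ n) (range (\<lambda>i. var i ^ a i))) = powers_ideal a L n"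
proof
  let ?S = "insert (L ^ n) (range (\<lambda>i. var i ^ a i))"
  interpret R: cring "mpoly_ring :: ('n, 'k) mpoly ring" by (rule cring_mpoly_ring)
  have "L ^ n - L ^ n * 1 \<in> box_ideal a" "var i ^ a i - L ^ n * 0 \<in> box_ideal a" for i
    using var_power_in_box_ideal[of i a] by simp_all
  hence "?S \<subseteq> powers_ideal a L n" unfolding powers_ideal_def by blast
  with ideal_powers_ideal show "Idl\<^bsub>mpoly_ring\<^esub> ?S \<subseteq> powers_ideal a L n"
    by (rule R.genideal_minimal)
  have "ideal (Idl\<^bsub>mpoly_ring\<^esub> ?S) mpoly_ring"
    by (rule R.genideal_ideal) (simp add: mpoly_ring_simps)
  note gen = ideal_mpolyD[OF this]
  have sub: "?S \<subseteq> Idl\<^bsub>mpoly_ring\<^esub> ?S"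
    by (rule R.genideal_self) (simp add: mpoly_ring_simps)
  show "powers_ideal a L n \<subseteq> Idl\<^bsub>mpoly_ring\<^esub> ?S"
  proof
    fix f assume "f \<in> powers_ideal a L n"
    then obtain g where g: "f - L ^ n * g \<in> box_ideal a" by (auto simp: powers_ideal_def)
    have "f - L ^ n * g \<in> Idl\<^bsub>mpoly_ring\<^esub> ?S"
      using g
    proof (induction rule: box_ideal_induct)
      case (single m c i)
      have "var i ^ a i \<in> Idl\<^bsub>mpoly_ring\<^esub> ?S" using sub by auto
      thus ?case unfolding single_eq_var_power_times[OF single] by (subst mult.commute) (rule gen(3))
    qed (auto intro: gen)
    moreover have "g * L ^ n \<in> Idl\<^bsub>mpoly_ring\<^esub> ?S" using sub by (intro gen(3)) auto
    ultimately have "(f - L ^ n * g) + g * L ^ n \<in> Idl\<^bsub>mpoly_ring\<^esub> ?S" by (rule gen(2))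
    thus "f \<in> Idl\<^bsub>mpoly_ring\<^esub> ?S" by (simp add: mult.commute)
  qed
qed

lemma quot_coset_eq_iff:
  fixes I :: "('n, 'k::comm_ring_1) mpoly set"
  assumes "ideal I mpoly_ring"
  shows "I +>\<^bsub>mpoly_ring\<^esub> f = I +>\<^bsub>mpoly_ring\<^esub> g \<longleftrightarrow> f - g \<in> I"
proof -
  have coset: "I +>\<^bsub>mpoly_ring\<^esub> f = (\<lambda>h. h + f) ` I" for f
    by (auto simp: a_r_coset_def' mpoly_ring_simps)
  note I = ideal_mpolyD[OF assms]
  have neg: "- x \<in> I" if "x \<in> I" for x using I(3)[OF that, of "- 1"] by simp
  show ?thesis
  proof
    assume "I +>\<^bsub>mpoly_ring\<^esub> f = I +>\<^bsub>mpoly_ring\<^esub> g"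
    moreover have "f \<in> I +>\<^bsub>mpoly_ring\<^esub> f" unfolding coset using I(1) by force
    ultimately obtain h where "h \<in> I" "f = h + g" unfolding coset by blast
    thus "f - g \<in> I" by simp
  next
    assume fg: "f - g \<in> I"
    have "h + f = (h + (f - g)) + g" "h + g = (h + - (f - g)) + f" for h by simp_all
    thus "I +>\<^bsub>mpoly_ring\<^esub> f = I +>\<^bsub>mpoly_ring\<^esub> g"
      unfolding coset using I(2) fg neg[OF fg] by blast
  qed
qed

lemma quot_times_coset:
  fixes I :: "('n, 'k::comm_ring_1) mpoly set"
  assumes "ideal I mpoly_ring"
  shows "quot_times I l (I +>\<^bsub>mpoly_ring\<^esub> f) = I +>\<^bsub>mpoly_ring\<^esub> (l * f)"
proof -
  interpret ideal I "mpoly_ring :: ('n, 'k) mpoly ring" by (rule assms)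
  show ?thesis
    using rcoset_mult_add[of l f] by (simp add: quot_times_def FactRing_def mpoly_ring_simps)
qed

text \<open>
  Maximal rank without cosets: every later argument is about membership of polynomials in the
  ideal.
\<close>

lemma maximal_rank_at_iff:
  fixes I :: "('n::finite, 'k::comm_ring_1) mpoly set"
  assumes "ideal I mpoly_ring" and "l \<in> homogeneous_part 1"
  shows "maximal_rank_at I l t \<longleftrightarrow>
    (\<forall>f\<in>homogeneous_part t. l * f \<in> I \<longrightarrow> f \<in> I) \<or>
    (\<forall>h\<in>homogeneous_part (t + 1). \<exists>f\<in>homogeneous_part t. h - l * f \<in> I)"
proof -
  note simps = quot_part_def quot_times_coset[OF assms(1)] quot_coset_eq_iff[OF assms(1)]
  have "inj_on (quot_times I l) (quot_part I t) \<longleftrightarrow> (\<forall>f\<in>homogeneous_part t. l * f \<in> I \<longrightarrow> f \<in> I)"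
    (is "?A \<longleftrightarrow> ?B")
  proof
    assume inj: ?A
    show ?B
    proof (intro ballI impI)
      fix f assume f: "f \<in> homogeneous_part t" "l * f \<in> I"
      have "I +>\<^bsub>mpoly_ring\<^esub> f \<in> quot_part I t" "I +>\<^bsub>mpoly_ring\<^esub> 0 \<in> quot_part I t"
        using f by (simp_all add: quot_part_def)
      moreover have "quot_times I l (I +>\<^bsub>mpoly_ring\<^esub> f) = quot_times I l (I +>\<^bsub>mpoly_ring\<^esub> 0)"
        using f by (simp add: quot_times_coset[OF assms(1)] quot_coset_eq_iff[OF assms(1)])
      ultimately have "I +>\<^bsub>mpoly_ring\<^esub> f = I +>\<^bsub>mpoly_ring\<^esub> 0" using inj by (simp add: inj_on_def)
      thus "f \<in> I" by (simp add: quot_coset_eq_iff[OF assms(1)])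
    qed
  next
    assume B: ?B
    show ?A
    proof (rule inj_onI)
      fix x y assume "x \<in> quot_part I t" "y \<in> quot_part I t" and eq: "quot_times I l x = quot_times I l y"
      then obtain f g where fg: "f \<in> homogeneous_part t" "g \<in> homogeneous_part t"
        "x = I +>\<^bsub>mpoly_ring\<^esub> f" "y = I +>\<^bsub>mpoly_ring\<^esub> g" by (auto simp: simps)
      hence "l * (f - g) \<in> I" using eq by (simp add: simps algebra_simps)
      thus "x = y" using B fg by (simp add: simps homogeneous_diff)
    qed
  qed
  moreover have "quot_times I l ` quot_part I t = quot_part I (t + 1)
     \<longleftrightarrow> (\<forall>h\<in>homogeneous_part (t + 1). \<exists>f\<in>homogeneous_part t. h - l * f \<in> I)" (is "?A \<longleftrightarrow> ?B")
  proof -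
    have img: "quot_times I l ` quot_part I t = (\<lambda>f. I +>\<^bsub>mpoly_ring\<^esub> (l * f)) ` homogeneous_part t"
      by (simp add: quot_part_def image_image quot_times_coset[OF assms(1)])
    have "l * f \<in> homogeneous_part (t + 1)" if "f \<in> homogeneous_part t" for f
      using homogeneous_mult[OF assms(2) that] by (simp add: add.commute)
    hence "quot_times I l ` quot_part I t \<subseteq> quot_part I (t + 1)"
      unfolding img unfolding quot_part_def by blast
    hence "?A \<longleftrightarrow> quot_part I (t + 1) \<subseteq> quot_times I l ` quot_part I t" by blast
    also have "\<dots> \<longleftrightarrow> (\<forall>h\<in>homogeneous_part (t + 1). \<exists>f\<in>homogeneous_part t.
        I +>\<^bsub>mpoly_ring\<^esub> h = I +>\<^bsub>mpoly_ring\<^esub> (l * f))"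
      unfolding img unfolding quot_part_def by blast
    finally show ?thesis by (simp add: quot_coset_eq_iff[OF assms(1)])
  qed
  ultimately show ?thesis unfolding maximal_rank_at_def by simp
qed

section \<open>General linear forms\<close>

lemma for_general_linear_formI:
  fixes p :: "('n::finite, 'k::field) mpoly"
  assumes "eval_mpoly c0 p \<noteq> 0" and "\<And>c. eval_mpoly c p \<noteq> 0 \<Longrightarrow> P (linear_form c)"
  shows "for_general_linear_form P"
  unfolding for_general_linear_form_def zariski_open_def zariski_closed_def
  using assms by (intro exI[of _ "{c. eval_mpoly c p \<noteq> 0}"]) (auto intro: exI[of _ "{p}"])

lemma for_general_linear_form_nonzero_coeffs:
  assumes "\<And>c. (\<And>i. c i \<noteq> 0) \<Longrightarrow> P (linear_form c)"
  shows "for_general_linear_form (P :: ('n::finite, 'k::field) mpoly \<Rightarrow> bool)"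
proof (rule for_general_linear_formI)
  show "eval_mpoly (\<lambda>_. 1) (\<Prod>i\<in>UNIV. var i :: ('n, 'k) mpoly) \<noteq> 0" by simp
qed (use assms in auto)

lemma for_general_linear_form_distinct_ratios:
  fixes c :: "'n::finite \<Rightarrow> 'k::field_char_0"
  assumes c: "\<And>i. c i \<noteq> 0"
    and P: "\<And>b. (\<And>i. b i \<noteq> 0) \<Longrightarrow> (\<And>i j. i \<noteq> j \<Longrightarrow> c i / b i \<noteq> c j / b j) \<Longrightarrow> P (linear_form b)"
  shows "for_general_linear_form P"
proof -
  obtain f :: "'n \<Rightarrow> nat" where f: "inj f"
    using finite_imp_inj_to_nat_seg[of "UNIV :: 'n set"] by auto
  \<comment> \<open>Multiples of \<open>c\<close> by distinct positive integers have distinct ratios.\<close>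
  define b0 where "b0 i = c i * of_nat (Suc (f i))" for i
  define q :: "('n, 'k) mpoly"
    where "q = (\<Prod>(i, j)\<in>{(i, j). i \<noteq> j}. Const (c i) * var j - Const (c j) * var i)"
  have q: "eval_mpoly b q \<noteq> 0 \<longleftrightarrow> (\<forall>i j. i \<noteq> j \<longrightarrow> c i * b j \<noteq> c j * b i)" for b
    by (auto simp: q_def case_prod_beta)
  show ?thesis
  proof (rule for_general_linear_formI)
    have "c i * b0 j \<noteq> c j * b0 i" if "i \<noteq> j" for i j
    proof
      assume "c i * b0 j = c j * b0 i"
      hence "(c i * c j) * of_nat (Suc (f j)) = (c i * c j) * (of_nat (Suc (f i)) :: 'k)"
        by (simp only: b0_def mult_ac)
      hence "f i = f j" using c by (simp del: of_nat_Suc)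
      thus False using f that by (auto dest: injD)
    qed
    moreover have "b0 i \<noteq> 0" for i using c by (simp add: b0_def del: of_nat_Suc)
    ultimately show "eval_mpoly b0 ((\<Prod>i\<in>UNIV. var i) * q) \<noteq> 0" by (simp add: q)
  next
    fix b assume "eval_mpoly b ((\<Prod>i\<in>UNIV. var i) * q) \<noteq> 0"
    hence b: "\<And>i. b i \<noteq> 0" and "\<And>i j. i \<noteq> j \<Longrightarrow> c i * b j \<noteq> c j * b i" by (auto simp: q)
    thus "P (linear_form b)" by (intro P) (auto simp: frac_eq_eq)
  qed
qed

section \<open>Lefschetz behaviour\<close>

lemma powers_ideal_homogeneous:
  assumes "f \<in> powers_ideal a (linear_form c) n" and "f \<in> homogeneous_part d"
  shows "\<exists>g\<in>homogeneous_part (d - int n). f - linear_form c ^ n * g \<in> box_ideal a"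
proof -
  from assms(1) obtain g where "f - linear_form c ^ n * g \<in> box_ideal a"
    by (auto simp: powers_ideal_def)
  hence "component d (f - linear_form c ^ n * g) \<in> box_ideal a" by (rule component_box_ideal)
  hence "f - linear_form c ^ n * component (d - int n) g \<in> box_ideal a"
    by (simp add: component_diff component_homogeneous[OF assms(2)]
        component_mult[OF homogeneous_power_linear_form])
  thus ?thesis using homogeneous_component by blast
qed

lemma apolar_box_ideal:
  assumes "p \<in> box_ideal a" and "\<And>i. (partial i ^^ a i) F = 0"
  shows "apolar p F = 0"
  using assms(1)
proof (induction p rule: box_ideal_induct)
  case (single m c i)
  show ?case
    by (simp only: single_eq_var_power_times[OF single] apolar_var_power_times assms(2) apolar_0_right)
qed (simp_all add: apolar_add)

text \<open>
  Pairing with \<open>F\<close> is a functional that kills the image of \<open>\<ell>\<close> and the ideal, by adjointness,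
  while a monomial of \<open>F\<close> pairs with it to a nonzero multiple of its coefficient.
\<close>

lemma not_surjective_if_apolar_form:
  fixes F :: "('n::finite, 'k::field_char_0) mpoly"
  assumes "F \<in> homogeneous_part d" "F \<noteq> 0" "dir_deriv b F = 0"
    and "\<And>i. (partial i ^^ a i) F = 0" and "(dir_deriv c ^^ n) F = 0"
  shows "\<exists>h\<in>homogeneous_part d. \<forall>f. h - linear_form b * f \<notin> powers_ideal a (linear_form c) n"
proof -
  obtain m where m: "lookup F m \<noteq> 0"
    using assms(2) by (metis poly_mapping_eqI lookup_zero)
  hence "single m 1 \<in> homogeneous_part d"
    using assms(1) single_homogeneous[of m 1] by (auto simp: homogeneous_iff)
  moreover have False if "single m 1 - linear_form b * f - linear_form c ^ n * g \<in> box_ideal a" for f g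
  proof -
    have "apolar (single m 1 - linear_form b * f - linear_form c ^ n * g) F = 0"
      by (rule apolar_box_ideal[OF that assms(4)])
    hence "monomial_fact m * lookup F m = 0"
      by (simp add: apolar_diff apolar_single apolar_linear_form_times
          apolar_linear_form_power_times assms(3,5))
    thus False using m monomial_fact_nonzero[where 'k='k, of m] by simp
  qed
  ultimately show ?thesis unfolding powers_ideal_def by blast
qed

text \<open>
  From the middle degree \<open>N\<close> on, surjectivity passes from the monomial complete intersection to
  its quotient. Below it, so does injectivity, because the degree of \<open>L ^ n\<close> is too large to
  matter. The exception is the map into degree \<open>N\<close> for \<open>n = N\<close>, where pairing with \<open>F\<close> shows that the coefficient of \<open>L ^ n\<close> must be zero.
\<close>

lemma maximal_rank_if_large_power:
  fixes b c :: "'n::finite \<Rightarrow> 'k::field_char_0"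
  assumes b: "\<And>i. b i \<noteq> 0" and N: "(\<Sum>i\<in>UNIV. int (a i) - 1) = 2 * int N" and "N \<le> n"
    and F: "n = N \<Longrightarrow> \<exists>F\<in>homogeneous_part (int N). eval_mpoly c F \<noteq> 0 \<and> dir_deriv b F = 0 \<and>
      (\<forall>i. (partial i ^^ a i) F = 0)"
  shows "maximal_rank_at (powers_ideal a (linear_form c) n) (linear_form b) t"
proof -
  let ?l = "linear_form b" and ?L = "linear_form c"
  let ?I = "powers_ideal a ?L n"
  have box: "f \<in> ?I" if "f \<in> box_ideal a" for f
    using that unfolding powers_ideal_def by (auto intro: exI[of _ 0])
  show ?thesis
    unfolding maximal_rank_at_iff[OF ideal_powers_ideal homogeneous_linear_form]
  proof (cases "t \<ge> int N")
    case True
    have "\<exists>f\<in>homogeneous_part t. h - ?l * f \<in> ?I" if "h \<in> homogeneous_part (t + 1)" for h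
      using lefschetz_surjective[where b = b and a = a and k = 1, OF b that] True N
      by (auto intro!: box)
    thus "(\<forall>f\<in>homogeneous_part t. ?l * f \<in> ?I \<longrightarrow> f \<in> ?I) \<or>
      (\<forall>h\<in>homogeneous_part (t + 1). \<exists>f\<in>homogeneous_part t. h - ?l * f \<in> ?I)" by blast
  next
    case False
    have "f \<in> ?I" if f: "f \<in> homogeneous_part t" and lf: "?l * f \<in> ?I" for f
    proof -
      have "?l * f \<in> homogeneous_part (1 + t)" by (rule homogeneous_mult) (simp_all add: f)
      from powers_ideal_homogeneous[OF lf this] obtain g where
        g: "g \<in> homogeneous_part (1 + t - int n)" "?l * f - ?L ^ n * g \<in> box_ideal a" by blast
      have "g = 0"
      proof (cases "1 + t < int n")
        case True
        thus ?thesis using g(1) homogeneous_negative by force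
      next
        case eq: False
        hence n: "n = N" "1 + t = int n" using False \<open>N \<le> n\<close> by auto
        from F[OF n(1)] obtain F where F: "F \<in> homogeneous_part (int n)" "eval_mpoly c F \<noteq> 0"
          "dir_deriv b F = 0" "\<And>i. (partial i ^^ a i) F = 0" unfolding n(1) by blast
        have "g \<in> homogeneous_part 0" using g(1) n(2) by simp
        then obtain x where x: "g = Const x" using homogeneous_0_eq_Const by blast
        have "apolar (?l * f - ?L ^ n * g) F = 0" by (rule apolar_box_ideal[OF g(2) F(4)])
        hence "x * (fact n * eval_mpoly c F) = 0"
          by (simp add: x apolar_diff apolar_linear_form_times F(3) mult.commute[of _ "Const x"]
              apolar_Const_times apolar_linear_form_power[OF F(1)])
        thus ?thesis using F(2) x by simp
      qed
      hence "?l ^ 1 * f \<in> box_ideal a" using g(2) by simp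
      thus ?thesis using lefschetz_injective[where b = b and a = a and k = 1, OF b f] False N
        by (intro box) simp
    qed
    thus "(\<forall>f\<in>homogeneous_part t. ?l * f \<in> ?I \<longrightarrow> f \<in> ?I) \<or>
      (\<forall>h\<in>homogeneous_part (t + 1). \<exists>f\<in>homogeneous_part t. h - ?l * f \<in> ?I)" by blast
  qed
qed

text \<open>
  The operator is of order two, so it lowers the exponent of \<open>L\<close> by at most two; the terms of
  first and second order combine into one linear form.
\<close>

lemma lower_linear_form_power:
  fixes b c :: "'n::finite \<Rightarrow> 'k::field_char_0"
  shows "lower a b (linear_form c ^ Suc (Suc d)) = linear_form c ^ d * (of_nat (Suc (Suc d)) *
    (Const (\<Sum>i\<in>UNIV. of_int (int (a i) - 1) * (c i / b i)) * linear_form c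
      - of_nat (Suc d) * linear_form (\<lambda>i. c i ^ 2 / b i)))"
proof -
  let ?L = "linear_form c" and ?B = "\<lambda>i. Const (inverse (b i)) :: ('n, 'k) mpoly"
    and ?C = "\<lambda>i. Const (c i) :: ('n, 'k) mpoly" and ?m = "of_nat (Suc (Suc d)) :: ('n, 'k) mpoly"
    and ?k = "of_nat (Suc d) :: ('n, 'k) mpoly"
  have C: "Const (of_int e * (x / y)) = of_int e * (Const x * Const (inverse y))"
    "Const (x ^ 2 / y) = Const x * Const x * Const (inverse y)" for e and x y :: 'k
    by (simp_all only: field_class.field_divide_inverse power2_eq_square Const_mult Const_of_int mult_ac)
  have p2: "partial i (?m * ?C i * ?L ^ Suc d) = ?m * ?C i * (?k * ?C i * ?L ^ d)" for i
    using partial_Const_times[of i "of_nat (Suc (Suc d)) * c i" "?L ^ Suc d"]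
    unfolding partial_power_linear_form Const_mult Const_of_nat .
  have "lower a b (?L ^ Suc (Suc d)) = (\<Sum>i\<in>UNIV. ?B i *
      (of_int (int (a i) - 1) * (?m * ?C i * ?L ^ Suc d) - var i * (?m * ?C i * (?k * ?C i * ?L ^ d))))"
    unfolding lower_def partial_power_linear_form p2 ..
  also have "\<dots> = (\<Sum>i\<in>UNIV. ?L ^ d * (?m * (of_int (int (a i) - 1) * (?C i * ?B i) * ?L
      - ?k * (?C i * ?C i * ?B i * var i))))"
    by (intro sum.cong refl) (simp only: power_Suc right_diff_distrib mult_ac)
  also have "\<dots> = ?L ^ d * (?m * (Const (\<Sum>i\<in>UNIV. of_int (int (a i) - 1) * (c i / b i)) * ?L
      - ?k * linear_form (\<lambda>i. c i ^ 2 / b i)))"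
    unfolding linear_form_alt[of "\<lambda>i. c i ^ 2 / b i"] Const_sum C
    by (simp only: sum_distrib_left sum_distrib_right sum_subtractf right_diff_distrib)
  finally show ?thesis .
qed

text \<open>
  By surjectivity above the middle degree, \<open>L ^ (N + 1) = \<ell> * v\<close> modulo the powers of the
  variables. In degree \<open>N\<close> the commutator of \<open>lower\<close> and \<open>\<ell>\<close> is zero, so \<open>f = lower v\<close>
  satisfies \<open>\<ell> * f = lower (L ^ (N + 1))\<close>, which is divisible by \<open>L ^ (N - 1)\<close> and hence by
  \<open>L ^ n\<close>. If \<open>f\<close> were in the ideal, injectivity of \<open>L ^ n\<close> would turn this into an equation
  \<open>L ^ (N - 1 - n) * u = \<ell> * g\<close> between polynomials of degree \<open>N - n\<close>, too small for the powers
  of the variables to interfere. It fails at some zero of \<open>\<ell>\<close>, because the linear form \<open>u\<close> comes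
  from the vectors \<open>c\<close> and \<open>c ^ 2 / b\<close>, which together with \<open>b\<close> are linearly independent as soon
  as three ratios \<open>c / b\<close> differ.
\<close>

lemma not_injective_if_small_power:
  fixes b c :: "'n::finite \<Rightarrow> 'k::field_char_0"
  assumes b: "\<And>i. b i \<noteq> 0" and c: "\<And>i. c i \<noteq> 0"
    and N: "(\<Sum>i\<in>UNIV. int (a i) - 1) = 2 * int N" and n: "n < N" "\<And>i. int N - int n < int (a i)"
    and t: "\<And>i j. i \<noteq> j \<Longrightarrow> c i / b i \<noteq> c j / b j" and "card (UNIV :: 'n set) \<ge> 3"
  shows "\<exists>f\<in>homogeneous_part (int N - 1). linear_form b * f \<in> powers_ideal a (linear_form c) n \<and>
    f \<notin> powers_ideal a (linear_form c) n"
proof -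
  let ?l = "linear_form b" and ?L = "linear_form c" and ?e = "\<Sum>i\<in>UNIV. int (a i) - 1"
  obtain d where d: "N = Suc d" using n by (cases N) auto
  define \<kappa> where "\<kappa> = (\<Sum>i\<in>UNIV. of_int (int (a i) - 1) * (c i / b i))"
  define u where "u = of_nat (Suc (Suc d)) * (Const \<kappa> * ?L - of_nat (Suc d) * linear_form (\<lambda>i. c i ^ 2 / b i))"
  have lower: "lower a b (?L ^ Suc N) = ?L ^ n * (?L ^ (d - n) * u)"
    using n unfolding d lower_linear_form_power \<kappa>_def[symmetric] u_def[symmetric]
    by (simp add: mult.assoc[symmetric] flip: power_add)
  have "?L ^ Suc N \<in> homogeneous_part (int (Suc N))" by (rule homogeneous_power_linear_form)
  from lefschetz_surjective[where a = a and b = b and k = 1, OF b this] N obtain v where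
    v: "v \<in> homogeneous_part (int N)" "?L ^ Suc N - ?l * v \<in> box_ideal a" by (auto simp del: power_Suc)
  define f where "f = lower a b v"
  have f: "f \<in> homogeneous_part (int N - 1)" unfolding f_def by (rule homogeneous_lower[OF v(1)])
  have lv: "lower a b (?l * v) = ?l * f"
    unfolding lower_linear_form_mult[OF v(1) b] f_def using N by simp
  have key: "?L ^ n * (?L ^ (d - n) * u) - ?l * f \<in> box_ideal a"
    using lower_box_ideal[OF v(2), where b = b] unfolding lower_diff lower lv .
  have "?l * f \<in> powers_ideal a ?L n"
    unfolding powers_ideal_def using box_ideal_diff_commute[OF key] by blast
  moreover have "f \<notin> powers_ideal a ?L n"
  proof
    assume "f \<in> powers_ideal a ?L n"
    from powers_ideal_homogeneous[OF this f] obtain g where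
      g: "g \<in> homogeneous_part (int N - 1 - int n)" "f - ?L ^ n * g \<in> box_ideal a" by blast
    define h where "h = ?L ^ (d - n) * u - ?l * g"
    have u: "u \<in> homogeneous_part 1"
      unfolding u_def Const_of_nat[symmetric]
      by (intro homogeneous_diff homogeneous_Const_times homogeneous_linear_form)
    have "?L ^ (d - n) * u \<in> homogeneous_part (int (d - n) + 1)"
      by (intro homogeneous_mult homogeneous_power_linear_form u)
    moreover have "?l * g \<in> homogeneous_part (1 + (int N - 1 - int n))"
      by (intro homogeneous_mult homogeneous_linear_form g)
    ultimately have h: "h \<in> homogeneous_part (int N - int n)"
      unfolding h_def using n d by (intro homogeneous_diff) (simp_all add: of_nat_diff algebra_simps)
    have "(?L ^ n * (?L ^ (d - n) * u) - ?l * f) + ?l * (f - ?L ^ n * g) \<in> box_ideal a"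
      by (intro box_ideal_add box_ideal_mult key g)
    hence "?L ^ n * h \<in> box_ideal a" by (simp add: h_def algebra_simps)
    hence "h \<in> box_ideal a"
      using lefschetz_injective[where b = c and k = n, OF c h] N n by simp
    hence "h = 0" using box_ideal_low_degree[where a = a, OF h n(2)] by blast
    hence h0: "?L ^ (d - n) * u = ?l * g" by (simp add: h_def)
    have tsum: "\<kappa> = of_nat (Suc d) * (c i / b i + c j / b j)" if ij: "i \<noteq> j" for i j
    proof -
      \<comment> \<open>A zero of \<open>\<ell>\<close> supported on two coordinates, where \<open>u\<close> factors as a difference of squares.\<close>
      define z where "z l = (if l = i then 1 / b i else if l = j then - (1 / b j) else 0)" for l
      have z: "eval_mpoly z (linear_form w) = w i / b i - w j / b j" for w
      proof -
        have "w l * z l = (if l = i then w i / b i else 0) - (if l = j then w j / b j else 0)" for l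
          using ij by (simp add: z_def)
        thus ?thesis by (simp add: sum_subtractf)
      qed
      have "eval_mpoly z (?L ^ (d - n) * u) = 0" unfolding h0 by (simp add: z b del: eval_linear_form)
      moreover have "eval_mpoly z ?L \<noteq> 0" using t[OF ij] by (simp add: z del: eval_linear_form)
      ultimately have "eval_mpoly z u = 0" by simp
      moreover have "eval_mpoly z u = of_nat (Suc (Suc d)) * ((c i / b i - c j / b j) *
          (\<kappa> - of_nat (Suc d) * (c i / b i + c j / b j)))"
        unfolding u_def eval_mult eval_diff eval_of_nat eval_Const z
        by (simp add: power2_eq_square algebra_simps del: of_nat_Suc)
      ultimately show ?thesis using t[OF ij] by (simp del: of_nat_Suc)
    qed
    obtain i j k :: 'n where ijk: "i \<noteq> j" "i \<noteq> k" "j \<noteq> k"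
    proof -
      obtain S :: "'n set" where "card S = 3" using assms(7) by (meson obtain_subset_with_card_n)
      thus ?thesis using that unfolding card_3_iff by blast
    qed
    have "of_nat (Suc d) * (c i / b i + c j / b j) = of_nat (Suc d) * (c i / b i + c k / b k)"
      using tsum ijk by metis
    hence "c j / b j = c k / b k" by (simp del: of_nat_Suc)
    thus False using t ijk by blast
  qed
  ultimately show ?thesis using f by blast
qed

definition exponents :: "nat \<Rightarrow> nat \<Rightarrow> nat \<Rightarrow> nat \<Rightarrow> 4 \<Rightarrow> nat"
  where "exponents a1 a2 a3 a4 i = (if i = 1 then a1 else if i = 2 then a2 else if i = 3 then a3 else a4)"

lemma exponents_simps [simp]:
  "exponents a1 a2 a3 a4 1 = a1" "exponents a1 a2 a3 a4 2 = a2"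
  "exponents a1 a2 a3 a4 3 = a3" "exponents a1 a2 a3 a4 4 = a4"
  using distinct_indices by (simp_all add: exponents_def)

lemma all_4: "(\<forall>i::4. P i) \<longleftrightarrow> P 1 \<and> P 2 \<and> P 3 \<and> P 4"
  using UNIV_4 by (metis UNIV_I empty_iff insert_iff)

lemma sum_4: "(\<Sum>i\<in>(UNIV :: 4 set). f i) = f 1 + f 2 + f 3 + (f 4 :: int)"
  unfolding UNIV_4 using distinct_indices by (simp add: algebra_simps)

lemma power_ideal_eq: "power_ideal a1 a2 a3 a4 a5 L = powers_ideal (exponents a1 a2 a3 a4) L a5"
proof -
  have "{var 1 ^ a1, var 2 ^ a2, var 3 ^ a3, var 4 ^ a4, L ^ a5}
     = insert (L ^ a5) (range (\<lambda>i. var i ^ exponents a1 a2 a3 a4 i))"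
    unfolding UNIV_4 by auto
  thus ?thesis unfolding power_ideal_def by (simp only: genideal_powers)
qed

text \<open>
  With \<open>N + 2\<close> half the sum of the \<open>a\<^sub>i\<close>, the exponents are the multiplicities with which the
  lines through pairs of coordinate points lie in the base locus of the translation invariant forms
  of degree \<open>N\<close> that have degree less than \<open>a\<^sub>i\<close> in the variables. Depending on the sign of \<open>a\<^sub>1 + a\<^sub>4 - (N + 2)\<close> the
  third line belongs to the indices 23 or 14; truncated subtraction makes the other exponent
  zero, so that one formula covers both cases.
\<close>

lemma exists_apolar_form:
  fixes b c :: "4 \<Rightarrow> 'k::field_char_0"
  assumes a: "2 \<le> a1" "a1 \<le> a2" "a2 \<le> a3" "a3 \<le> a4" "a1 + a2 + a3 + a4 = 2 * (N + 2)"
    and k: "k < a1" "k + a4 \<le> N + 1"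
    and b: "\<And>i. b i \<noteq> 0" and t: "\<And>i j. i \<noteq> j \<Longrightarrow> c i / b i \<noteq> c j / b j"
  shows "\<exists>F\<in>homogeneous_part (int N). F \<noteq> 0 \<and> dir_deriv b F = 0 \<and>
    (\<forall>i. (partial i ^^ exponents a1 a2 a3 a4 i) F = 0) \<and> (dir_deriv c ^^ (N + 1 - k)) F = 0 \<and>
    (k = 0 \<longrightarrow> eval_mpoly c F \<noteq> 0)"
proof -
  define p where "p = N + 2 - a1 - a2"
  define q where "q = N + 2 - a1 - a3"
  define r where "r = N + 2 - a1 - a4"
  define s where "s = a1 + a4 - (N + 2)"
  define n where "n = a1 - 1 - s - k"
  have "p + q + r + s + 2 * k + 2 * n = N" "Suc (s + k + n) = a1" "Suc (q + r + k + n) = a2"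
    "Suc (p + r + k + n) = a3" "Suc (p + q + s + k + n) = a4"
    "Suc (p + q + r + s + k + 2 * n) = N + 1 - k"
    using a k by (simp_all add: p_def q_def r_def s_def n_def)
  with exists_invariant_form[where b = b and c = c and p = p and q = q and r = r and s = s
      and k = k and n = n, OF b t]
  show ?thesis by (simp only: all_4 exponents_simps) blast
qed

theorem theorem3p2:
  fixes a1 a2 a3 a4 a5 :: nat and lam :: int
  assumes "2 \<le> a1" and "a1 \<le> a2" and "a2 \<le> a3" and "a3 \<le> a4" and "a4 \<le> a5"
    and "even (a1 + a2 + a3 + a4)"
    and "lam = int (a1 + a2 + a3 + a4) div 2 - 2"
  shows "for_general_linear_form (\<lambda>L :: (4, 'k::field_char_0) mpoly.
      (int a5 \<ge> lam \<longrightarrow> weak_lefschetz (power_ideal a1 a2 a3 a4 a5 L)) \<and>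
      (int a5 < lam \<and> a1 + a4 \<ge> a2 + a3 \<longrightarrow>
         fails_weak_lefschetz_to (power_ideal a1 a2 a3 a4 a5 L) lam) \<and>
      (int a5 < lam \<and> a1 + a4 < a2 + a3 \<and>
         2 * int a5 + int a1 - int a2 - int a3 - int a4 \<ge> 0 \<longrightarrow>
         fails_weak_lefschetz_to (power_ideal a1 a2 a3 a4 a5 L) lam)) \<and>
    (int a5 < lam \<and> a1 + a4 \<ge> a2 + a3 \<longrightarrow> a1 \<ge> 3) \<and>
    (int a5 < lam \<and> a1 + a4 < a2 + a3 \<and>
       2 * int a5 + int a1 - int a2 - int a3 - int a4 \<ge> 0 \<longrightarrow> a1 \<ge> 3)"
proof -
  let ?a = "exponents a1 a2 a3 a4"
  obtain h where h: "a1 + a2 + a3 + a4 = 2 * h" using assms(6) by (rule evenE)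
  define N where "N = h - 2"
  have N: "a1 + a2 + a3 + a4 = 2 * (N + 2)" using h assms(1-4) by (simp add: N_def)
  hence lam: "lam = int N" using assms(7) by simp
  have socle: "(\<Sum>i\<in>UNIV. int (?a i) - 1) = 2 * int N" using N by (simp add: sum_4)
  \<comment> \<open>The hypotheses of (ii) and of (iii) each keep the degree \<open>N - a5\<close> below \<open>a1 - 1\<close>.\<close>
  have small: "N + 2 \<le> a1 + a5" if "int a5 < lam"
    "a1 + a4 \<ge> a2 + a3 \<or> 2 * int a5 + int a1 - int a2 - int a3 - int a4 \<ge> 0"
    using that N assms(1-5) by (auto simp: lam)
  have wlp: "weak_lefschetz (power_ideal a1 a2 a3 a4 a5 (linear_form c))"
    if "int a5 \<ge> lam" and c: "\<And>i. c i \<noteq> 0" for c :: "4 \<Rightarrow> 'k"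
    unfolding weak_lefschetz_def power_ideal_eq
  proof (rule for_general_linear_form_distinct_ratios[OF c], intro allI)
    fix b :: "4 \<Rightarrow> 'k" and t
    assume b: "\<And>i. b i \<noteq> 0" and t: "\<And>i j. i \<noteq> j \<Longrightarrow> c i / b i \<noteq> c j / b j"
    show "maximal_rank_at (powers_ideal ?a (linear_form c) a5) (linear_form b) t"
    proof (rule maximal_rank_if_large_power[OF b socle])
      show "N \<le> a5" using \<open>int a5 \<ge> lam\<close> by (simp add: lam)
    next
      assume "a5 = N"
      thus "\<exists>F\<in>homogeneous_part (int N). eval_mpoly c F \<noteq> 0 \<and> dir_deriv b F = 0 \<and>
          (\<forall>i. (partial i ^^ ?a i) F = 0)"
        using exists_apolar_form[OF assms(1-4) N, of 0 b c] assms(1,5) b t by auto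
    qed
  qed
  have fails: "fails_weak_lefschetz_to (power_ideal a1 a2 a3 a4 a5 (linear_form c)) lam"
    if "int a5 < lam" and "N + 2 \<le> a1 + a5" and c: "\<And>i. c i \<noteq> 0" for c :: "4 \<Rightarrow> 'k"
    unfolding fails_weak_lefschetz_to_def power_ideal_eq
  proof (rule for_general_linear_form_distinct_ratios[OF c])
    fix b :: "4 \<Rightarrow> 'k"
    assume b: "\<And>i. b i \<noteq> 0" and t: "\<And>i j. i \<noteq> j \<Longrightarrow> c i / b i \<noteq> c j / b j"
    let ?I = "powers_ideal ?a (linear_form c) a5"
    have a5: "a5 < N" using \<open>int a5 < lam\<close> by (simp add: lam)
    have "\<forall>i. int N - int a5 < int (?a i)" unfolding all_4 using that(2) assms(1-4) by simp
    hence "\<exists>f\<in>homogeneous_part (int N - 1). linear_form b * f \<in> ?I \<and> f \<notin> ?I"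
      by (intro not_injective_if_small_power[OF b c socle a5 _ t]) simp_all
    moreover have "\<exists>h\<in>homogeneous_part (int N). \<forall>f. h - linear_form b * f \<notin> ?I"
    proof -
      \<comment> \<open>This many conics through \<open>c\<close> bring the degree along \<open>c\<close> below \<open>a5\<close>.\<close>
      have k: "N + 1 - a5 < a1" "N + 1 - a5 + a4 \<le> N + 1" "N + 1 - (N + 1 - a5) = a5"
        "N + 1 - a5 \<noteq> 0"
        using a5 that(2) assms(5) by linarith+
      from exists_apolar_form[where b = b and c = c, OF assms(1-4) N k(1,2) b t] k(3,4) obtain F where "F \<in> homogeneous_part (int N)" "F \<noteq> 0" "dir_deriv b F = 0"
        "\<And>i. (partial i ^^ ?a i) F = 0" "(dir_deriv c ^^ a5) F = 0" by auto
      thus ?thesis by (rule not_surjective_if_apolar_form)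
    qed
    ultimately show "\<not> maximal_rank_at ?I (linear_form b) (lam - 1)"
      unfolding maximal_rank_at_iff[OF ideal_powers_ideal homogeneous_linear_form] lam by auto
  qed
  have "a1 \<ge> 3" if "int a5 < lam"
    "a1 + a4 \<ge> a2 + a3 \<or> 2 * int a5 + int a1 - int a2 - int a3 - int a4 \<ge> 0"
    using small[OF that] that(1) by (simp add: lam)
  moreover have "for_general_linear_form (\<lambda>L :: (4, 'k) mpoly.
      (int a5 \<ge> lam \<longrightarrow> weak_lefschetz (power_ideal a1 a2 a3 a4 a5 L)) \<and>
      (int a5 < lam \<and> a1 + a4 \<ge> a2 + a3 \<longrightarrow>
         fails_weak_lefschetz_to (power_ideal a1 a2 a3 a4 a5 L) lam) \<and>
      (int a5 < lam \<and> a1 + a4 < a2 + a3 \<and>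
         2 * int a5 + int a1 - int a2 - int a3 - int a4 \<ge> 0 \<longrightarrow>
         fails_weak_lefschetz_to (power_ideal a1 a2 a3 a4 a5 L) lam))"
    by (rule for_general_linear_form_nonzero_coeffs) (use wlp fails small in blast)
  ultimately show ?thesis by blast
qed

end
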